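(* Let $\mathbb{H}^2$ be the real hyperbolic plane, let $T_3$ be the infinite $3$-regular tree, and let $Z$ be a bounded degree graph with polynomial growth. Then there is no regular map $\mathbb{H}^2\to T_3\times Z$.
   Context: A map $f:X\to Y$ between metric spaces is regular if there is $\kappa$ such that (i) $d_Y(f(x),f(x'))\leq \kappa(1+d_X(x,x'))$ for all $x,x'\in X$, and (ii) the preimage of every open ball of radius $1$ in $Y$ is contained in a union of at most $\kappa$ balls of radius $1$ in $X$. Graphs carry their shortest path metric; $T_3\times Z$ carries a product metric (e.g. $\ell^1$). A bounded degree graph $Z$ has polynomial growth if there are $C,d>0$ with $|B(z,r)|\leq Cr^d+C$ for all vertices $z$ and $r\geq 0$. *)

theory Defs
  imports "HOL-Analysis.Analysis"
begin

definition simple_graph :: "'a set \<Rightarrow> ('a \<Rightarrow> 'a \<Rightarrow> bool) \<Rightarrow> bool" where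
  "simple_graph V E \<longleftrightarrow> (\<forall>x y. E x y \<longrightarrow> x \<in> V \<and> y \<in> V \<and> x \<noteq> y \<and> E y x)"

definition walk :: "'a set \<Rightarrow> ('a \<Rightarrow> 'a \<Rightarrow> bool) \<Rightarrow> 'a list \<Rightarrow> bool" where
  "walk V E xs \<longleftrightarrow> xs \<noteq> [] \<and> set xs \<subseteq> V \<and> (\<forall>i. Suc i < length xs \<longrightarrow> E (xs ! i) (xs ! Suc i))"

definition graph_connected :: "'a set \<Rightarrow> ('a \<Rightarrow> 'a \<Rightarrow> bool) \<Rightarrow> bool" where
  "graph_connected V E \<longleftrightarrow> (\<forall>x\<in>V. \<forall>y\<in>V. \<exists>xs. walk V E xs \<and> hd xs = x \<and> last xs = y)"

definition gdist :: "'a set \<Rightarrow> ('a \<Rightarrow> 'a \<Rightarrow> bool) \<Rightarrow> 'a \<Rightarrow> 'a \<Rightarrow> real" where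
  "gdist V E x y = real (LEAST n. \<exists>xs. walk V E xs \<and> hd xs = x \<and> last xs = y \<and> length xs = Suc n)"

definition degree :: "'a set \<Rightarrow> ('a \<Rightarrow> 'a \<Rightarrow> bool) \<Rightarrow> 'a \<Rightarrow> nat" where
  "degree V E v = card {w \<in> V. E v w}"

definition bounded_degree :: "'a set \<Rightarrow> ('a \<Rightarrow> 'a \<Rightarrow> bool) \<Rightarrow> bool" where
  "bounded_degree V E \<longleftrightarrow> (\<exists>D::nat. \<forall>v\<in>V. finite {w \<in> V. E v w} \<and> card {w \<in> V. E v w} \<le> D)"

definition graph_cycle :: "('a \<Rightarrow> 'a \<Rightarrow> bool) \<Rightarrow> 'a list \<Rightarrow> bool" where
  "graph_cycle E xs \<longleftrightarrow> length xs \<ge> 3 \<and> distinct xs \<and>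
     (\<forall>i < length xs. E (xs ! i) (xs ! ((i + 1) mod length xs)))"

definition is_tree :: "'a set \<Rightarrow> ('a \<Rightarrow> 'a \<Rightarrow> bool) \<Rightarrow> bool" where
  "is_tree V E \<longleftrightarrow> simple_graph V E \<and> graph_connected V E \<and> V \<noteq> {} \<and>
     \<not> (\<exists>xs. set xs \<subseteq> V \<and> graph_cycle E xs)"

text \<open>The infinite 3-regular tree T_3 (unique up to isomorphism).\<close>
definition is_T3 :: "'a set \<Rightarrow> ('a \<Rightarrow> 'a \<Rightarrow> bool) \<Rightarrow> bool" where
  "is_T3 V E \<longleftrightarrow> is_tree V E \<and> (\<forall>v\<in>V. finite {w \<in> V. E v w} \<and> degree V E v = 3)"

definition polynomial_growth :: "'a set \<Rightarrow> ('a \<Rightarrow> 'a \<Rightarrow> bool) \<Rightarrow> bool" where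
  "polynomial_growth V E \<longleftrightarrow> (\<exists>C d::real. C > 0 \<and> d > 0 \<and>
     (\<forall>z\<in>V. \<forall>r::real. r \<ge> 0 \<longrightarrow>
        finite {v \<in> V. gdist V E z v \<le> r} \<and>
        real (card {v \<in> V. gdist V E z v \<le> r}) \<le> C * r powr d + C))"

definition H2 :: "complex set" where
  "H2 = {z. Im z > 0}"

definition hdist :: "complex \<Rightarrow> complex \<Rightarrow> real" where
  "hdist z w = arcosh (1 + (cmod (z - w))\<^sup>2 / (2 * Im z * Im w))"

definition regular_map ::
  "'a set \<Rightarrow> ('a \<Rightarrow> 'a \<Rightarrow> real) \<Rightarrow> 'b set \<Rightarrow> ('b \<Rightarrow> 'b \<Rightarrow> real) \<Rightarrow> ('a \<Rightarrow> 'b) \<Rightarrow> bool" where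
  "regular_map X dX Y dY f \<longleftrightarrow> f ` X \<subseteq> Y \<and>
     (\<exists>\<kappa>::real.
        (\<forall>x\<in>X. \<forall>x'\<in>X. dY (f x) (f x') \<le> \<kappa> * (1 + dX x x')) \<and>
        (\<forall>y\<in>Y. \<exists>Cs. finite Cs \<and> Cs \<subseteq> X \<and> real (card Cs) \<le> \<kappa> \<and>
            {x \<in> X. dY y (f x) < 1} \<subseteq> (\<Union>c\<in>Cs. {x \<in> X. dX c x < 1})))"

definition l1_prod_dist :: "('a \<Rightarrow> 'a \<Rightarrow> real) \<Rightarrow> ('b \<Rightarrow> 'b \<Rightarrow> real) \<Rightarrow> 'a \<times> 'b \<Rightarrow> 'a \<times> 'b \<Rightarrow> real" where
  "l1_prod_dist d1 d2 p q = d1 (fst p) (fst q) + d2 (snd p) (snd q)"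

end

theory Submission
  imports Defs "HOL-Real_Asymp.Real_Asymp"
begin

text \<open>
  Let \<open>f = (g, h)\<close> be regular. On a fibre of \<open>g\<close>, thickened by a constant, \<open>h\<close> is injective up to
  bounded multiplicity, so such a set has at most polynomially many (of a fixed degree \<open>D\<close>) separated
  points in a ball of radius \<open>R\<close>. This is contradicted as follows.

  A map from a rectangle to a tree has a thickened fibre that crosses the rectangle in one of the two
  directions. In the upper half plane, a rectangle whose width is a large multiple of the height of its
  upper side cannot be crossed horizontally by a set of polynomial growth. Hence there are vertical
  crossings, and they remain close to vertical geodesics: near every point there starts a downward
  vertical geodesic, of any prescribed length \<open>R\<close>, whose \<open>g\<close>-image is bounded. The same applies at
  points next to this geodesic at all heights, so that it branches about \<open>R\<close> times. After \<open>D + 1\<close>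
  rounds of branching one obtains about \<open>R ^ (D + 1)\<close> separated points in a ball of
  radius \<open>O(R)\<close> with bounded \<open>g\<close>-image.
\<close>

subsection \<open>Distances in graphs and trees\<close>

text \<open>The tree factor gives the target exponential growth, so counting points in large balls
  is no contradiction by itself. What helps is that a fibre of \<open>g\<close> only sees
  \<open>Z\<close>: thickening it by \<open>s\<close> costs a factor \<open>4 ^ s\<close> but leaves
  the degree \<open>D\<close> unchanged. Each round of branching may therefore worsen the thickness,
  since the number of rounds is fixed before \<open>R\<close> grows. The tree enters because each of
  its vertices separates it: two crossings of a rectangle that avoid a thickened fibre must meet, so
  both lie over the same branch. The plane enters through the distortion of horizontal lines: points
  at height \<open>\<eta>\<close> and horizontal distance \<open>L * \<eta>\<close> are only about
  \<open>2 * ln L\<close> apart for large \<open>L\<close>. A horizontal crossing thus packs too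
  many separated points into a small ball and is excluded at once. A vertical line carries only
  linearly many, which is no contradiction, so it has to be made to branch.\<close>

definition wdist :: "'a set \<Rightarrow> ('a \<Rightarrow> 'a \<Rightarrow> bool) \<Rightarrow> 'a \<Rightarrow> 'a \<Rightarrow> nat" where
  "wdist V E x y = (LEAST n. \<exists>xs. walk V E xs \<and> hd xs = x \<and> last xs = y \<and> length xs = Suc n)"

lemma gdist_wdist: "gdist V E x y = real (wdist V E x y)"
  by (simp add: gdist_def wdist_def)

lemma gdist_nonneg: "gdist V E x y \<ge> 0"
  by (simp add: gdist_wdist)

lemma wdist_refl: "x \<in> V \<Longrightarrow> wdist V E x x = 0"
  unfolding wdist_def
  by (rule Least_eq_0) (auto simp: walk_def intro!: exI[of _ "[x]"])

lemma walk_Cons: "walk V E (x # xs) \<longleftrightarrow> x \<in> V \<and> (xs = [] \<or> E x (hd xs) \<and> walk V E xs)"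
proof (cases xs)
  case (Cons y ys)
  have "(\<forall>i. Suc i < length (x # xs) \<longrightarrow> E ((x # xs) ! i) ((x # xs) ! Suc i)) \<longleftrightarrow>
    E x y \<and> (\<forall>i. Suc i < length xs \<longrightarrow> E (xs ! i) (xs ! Suc i))"
    unfolding Cons by (auto simp: nth_Cons split: nat.splits)
  then show ?thesis using Cons unfolding walk_def by auto
qed (auto simp: walk_def)

text \<open>Replaces lists of vertices by powers of the edge relation, so that distances can be
  handled with \<open>relpow_add\<close> and \<open>relpow_commute\<close>.\<close>

lemma walk_iff_relpow:
  assumes "simple_graph V E" "x \<in> V"
  shows "(\<exists>xs. walk V E xs \<and> hd xs = x \<and> last xs = y \<and> length xs = Suc n)
    \<longleftrightarrow> (x, y) \<in> {(x, y). E x y} ^^ n" (is "?L n x \<longleftrightarrow> (x, y) \<in> ?R ^^ n")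
  using assms(2)
proof (induction n arbitrary: x)
  case 0
  have "?L 0 x \<longleftrightarrow> x = y"
  proof
    assume "?L 0 x"
    then obtain xs where "hd xs = x" "last xs = y" "length xs = Suc 0" by blast
    then show "x = y" by (cases xs) auto
  next
    assume "x = y"
    then show "?L 0 x" using 0 by (intro exI[of _ "[x]"]) (auto simp: walk_def)
  qed
  then show ?case by simp
next
  case (Suc n)
  have "?L (Suc n) x \<longleftrightarrow> (\<exists>z. E x z \<and> ?L n z)"
  proof
    assume "?L (Suc n) x"
    then obtain xs where xs: "walk V E xs" "hd xs = x" "last xs = y" "length xs = Suc (Suc n)"
      by blast
    then obtain a ys where "xs = a # ys" "ys \<noteq> []"
      by (metis length_0_conv length_Suc_conv nat.distinct(1))
    with xs show "\<exists>z. E x z \<and> ?L n z" by (auto simp: walk_Cons)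
  next
    assume "\<exists>z. E x z \<and> ?L n z"
    then obtain z ys where "E x z" "walk V E ys" "hd ys = z" "last ys = y" "length ys = Suc n"
      by blast
    then show "?L (Suc n) x" using Suc.prems
      by (intro exI[of _ "x # ys"]) (auto simp: walk_Cons)
  qed
  also have "\<dots> \<longleftrightarrow> (\<exists>z. E x z \<and> (z, y) \<in> ?R ^^ n)"
    using Suc.IH assms(1) unfolding simple_graph_def by blast
  also have "\<dots> \<longleftrightarrow> (x, y) \<in> ?R ^^ Suc n" 
    unfolding relpow.simps relpow_commute[symmetric] by blast
  finally show ?case .
qed

locale connected_graph =
  fixes V :: "'a set" and E :: "'a \<Rightarrow> 'a \<Rightarrow> bool"
  assumes simple: "simple_graph V E" and conn: "graph_connected V E"
begin

abbreviation d where "d \<equiv> wdist V E"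
abbreviation R where "R \<equiv> {(x, y). E x y}"

lemma E_sym: "E x y \<Longrightarrow> E y x" and E_in: "E x y \<Longrightarrow> x \<in> V" "E x y \<Longrightarrow> y \<in> V"
  and E_neq: "E x y \<Longrightarrow> x \<noteq> y"
  using simple unfolding simple_graph_def by blast+

lemma d_eq: "x \<in> V \<Longrightarrow> d x y = (LEAST n. (x, y) \<in> R ^^ n)"
  unfolding wdist_def using walk_iff_relpow[OF simple] by simp

lemma d_le: "x \<in> V \<Longrightarrow> (x, y) \<in> R ^^ n \<Longrightarrow> d x y \<le> n"
  by (simp add: d_eq Least_le)

lemma relpow_d:
  assumes "x \<in> V" "y \<in> V" shows "(x, y) \<in> R ^^ d x y"
proof -
  obtain xs where xs: "walk V E xs" "hd xs = x" "last xs = y"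
    using conn assms unfolding graph_connected_def by blast
  then have "length xs = Suc (length xs - 1)" by (cases xs) (auto simp: walk_def)
  with xs have "\<exists>n. (x, y) \<in> R ^^ n"
    using walk_iff_relpow[OF simple assms(1)] by blast
  from LeastI_ex[OF this] show ?thesis by (simp add: d_eq assms)
qed

lemma relpow_sym: "(x, y) \<in> R ^^ n \<Longrightarrow> (y, x) \<in> R ^^ n"
proof (induction n arbitrary: y)
  case (Suc n)
  then obtain z where "(x, z) \<in> R ^^ n" "E z y" by auto
  then show ?case using Suc.IH[of z] E_sym by (intro relpow_Suc_I2[of y z]) auto
qed auto

lemma d_sym: "x \<in> V \<Longrightarrow> y \<in> V \<Longrightarrow> d x y = d y x"
  by (meson d_le relpow_d relpow_sym le_antisym)

lemma d_triangle: 
  assumes "x \<in> V" "y \<in> V" "z \<in> V" shows "d x z \<le> d x y + d y z"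
  using relpow_d[OF assms(1,2)] relpow_d[OF assms(2,3)] assms
  by (intro d_le) (auto simp: relpow_add)

lemma d_eq_0: "x \<in> V \<Longrightarrow> y \<in> V \<Longrightarrow> d x y = 0 \<longleftrightarrow> x = y"
  using relpow_d[of x y] wdist_refl[of x] by auto

lemma d_edge: "E x y \<Longrightarrow> d x y \<le> 1"
  by (rule d_le) (auto dest: E_in)

lemma closer_neighbour:
  assumes "x \<in> V" "y \<in> V" "x \<noteq> y"
  obtains z where "E x z" "d x y = Suc (d z y)"
proof -
  obtain n where n: "d x y = Suc n" using d_eq_0[OF assms(1,2)] assms(3) by (cases "d x y") auto
  then have "(x, y) \<in> R O R ^^ n" using relpow_d[OF assms(1,2)] by (simp add: relpow_commute)
  then obtain z where z: "E x z" "(z, y) \<in> R ^^ n" by auto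
  then have "d z y \<le> n" by (meson d_le E_in)
  moreover have "d x y \<le> d x z + d z y" using d_triangle[of x z y] E_in[OF z(1)] assms by simp
  ultimately show ?thesis using that[OF z(1)] n d_edge[OF z(1)] by linarith
qed

lemma d_edge_le: "E x y \<Longrightarrow> z \<in> V \<Longrightarrow> d z y \<le> Suc (d z x)"
  using d_triangle[of z x y] d_edge[of x y] E_in[of x y] by simp

text \<open>A point of the next ball is the centre or has a neighbour in the present ball, so each
  step multiplies the size by at most \<open>Suc k\<close>. For degree 3 this is the origin of the
  factor \<open>4 ^ s\<close>.\<close>

lemma ball_card_le:
  assumes "\<And>v. v \<in> V \<Longrightarrow> finite {w \<in> V. E v w} \<and> card {w \<in> V. E v w} \<le> k" "x \<in> V"
  shows "finite {y \<in> V. d x y \<le> n} \<and> card {y \<in> V. d x y \<le> n} \<le> Suc k ^ n"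
proof (induction n)
  case 0
  have "{y \<in> V. d x y \<le> 0} = {x}" using d_eq_0 assms(2) by auto
  then show ?case by simp
next
  case (Suc n)
  let ?B = "{y \<in> V. d x y \<le> n}"
  have sub: "{y \<in> V. d x y \<le> Suc n} \<subseteq> ?B \<union> (\<Union>z\<in>?B. {w \<in> V. E z w})"
  proof
    fix y assume y: "y \<in> {y \<in> V. d x y \<le> Suc n}"
    show "y \<in> ?B \<union> (\<Union>z\<in>?B. {w \<in> V. E z w})"
    proof (cases "y = x")
      case True
      then show ?thesis using wdist_refl[of x V E] y by simp
    next
      case False
      then obtain z where z: "E y z" "d y x = Suc (d z x)"
        using closer_neighbour[of y x] y assms(2) by auto
      then have "z \<in> ?B" using y d_sym[of x] E_in[OF z(1)] assms(2) by auto
      then show ?thesis using y E_sym[OF z(1)] by blast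
    qed
  qed
  have fin: "finite (?B \<union> (\<Union>z\<in>?B. {w \<in> V. E z w}))"
    using Suc assms(1) by auto
  have "card {y \<in> V. d x y \<le> Suc n} \<le> card (?B \<union> (\<Union>z\<in>?B. {w \<in> V. E z w}))"
    by (rule card_mono[OF fin sub])
  also have "\<dots> \<le> card ?B + card (\<Union>z\<in>?B. {w \<in> V. E z w})" by (rule card_Un_le)
  also have "card (\<Union>z\<in>?B. {w \<in> V. E z w}) \<le> (\<Sum>z\<in>?B. card {w \<in> V. E z w})"
    using Suc by (intro card_UN_le) simp
  also have "\<dots> \<le> (\<Sum>z\<in>?B. k)" using assms(1) by (intro sum_mono) auto
  finally have "card {y \<in> V. d x y \<le> Suc n} \<le> card ?B * Suc k" by simp
  also have "\<dots> \<le> Suc k ^ n * Suc k" by (intro mult_right_mono) (use Suc in auto)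
  finally show ?case using finite_subset[OF sub fin] by (simp add: mult.commute)
qed

text \<open>A shortest walk from \<open>a\<close> to \<open>b\<close> that does not use the edge
  between them repeats no vertex, since a repetition could be cut out. It has length at least 2,
  because a single step would be the excluded edge, and that edge closes it to a cycle.\<close>

lemma cycle_of_walk:
  assumes "E a b" "(a, b) \<in> {(x, y). E x y \<and> {x, y} \<noteq> {a, b}} ^^ n"
  obtains xs where "set xs \<subseteq> V" "graph_cycle E xs"
proof -
  let ?S = "{(x, y). E x y \<and> {x, y} \<noteq> {a, b}}"
  define n where "n = (LEAST n. (a, b) \<in> ?S ^^ n)"
  have n: "(a, b) \<in> ?S ^^ n" unfolding n_def by (rule LeastI) (rule assms(2))
  have minimal: "n \<le> m" if "(a, b) \<in> ?S ^^ m" for m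
    unfolding n_def by (rule Least_le) (rule that)
  obtain f where f: "f 0 = a" "f n = b" "\<And>i. i < n \<Longrightarrow> (f i, f (Suc i)) \<in> ?S"
    using n unfolding relpow_fun_conv by blast
  have seg: "(f i, f (i + k)) \<in> ?S ^^ k" if "i + k \<le> n" for i k
    unfolding relpow_fun_conv using that f(3) by (intro exI[of _ "\<lambda>l. f (i + l)"]) auto
  have "f i \<noteq> f j" if "i < j" "j \<le> n" for i j
  proof
    assume "f i = f j"
    then have "(a, b) \<in> ?S ^^ i O ?S ^^ (n - j)"
      using seg[of 0 i] seg[of j "n - j"] that f by auto
    then have "n \<le> i + (n - j)" by (intro minimal) (simp add: relpow_add)
    then show False using that by simp
  qed
  then have "inj_on f {0..<Suc n}" by (intro linorder_inj_onI) auto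
  have "n \<noteq> 0" using f E_neq[OF assms(1)] by (cases n) auto
  moreover have "n \<noteq> 1" using f by fastforce
  ultimately have "n \<ge> 2" by simp
  have E: "E (f i) (f (Suc i))" if "i < n" for i using f(3)[OF that] by simp
  have "E (map f [0..<Suc n] ! i) (map f [0..<Suc n] ! (Suc i mod Suc n))" if "i < Suc n" for i
  proof (cases "i = n")
    case True
    then show ?thesis using f(1,2) E_sym[OF assms(1)] by (simp del: upt_Suc)
  next
    case False
    then show ?thesis using that E[of i] by (simp del: upt_Suc)
  qed
  moreover have "set (map f [0..<Suc n]) \<subseteq> V"
  proof -
    have "f i \<in> V" if "i \<le> n" for i
      using that E[of i] f(2) E_in[OF assms(1)] E_in by (cases "i = n") auto
    then show ?thesis by auto
  qed
  ultimately show ?thesis using \<open>inj_on f _\<close> \<open>n \<ge> 2\<close>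
    by (intro that[of "map f [0..<Suc n]"]) (auto simp: graph_cycle_def distinct_map simp del: upt_Suc)
qed

end

section \<open>Separation in trees, derived from the fact that every edge is a bridge\<close>

locale tree = connected_graph +
  assumes acyclic: "set xs \<subseteq> V \<Longrightarrow> \<not> graph_cycle E xs"
begin

lemma bridge: "E a b \<Longrightarrow> (a, b) \<notin> {(x, y). E x y \<and> {x, y} \<noteq> {a, b}}\<^sup>*"
  using acyclic cycle_of_walk by (metis (no_types, lifting) rtrancl_power)

text \<open>After \<open>a\<close>, all vertices of a geodesic to \<open>x\<close> are strictly
  closer to \<open>x\<close> than \<open>a\<close>, while \<open>u\<close> and \<open>v\<close> are
  not. So every edge of the geodesic has an end outside \<open>{u, v}\<close>.\<close>

lemma geodesic_avoids:
  assumes "a \<in> V" "x \<in> V" "u \<in> V" "v \<in> V" "u \<noteq> v"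
    and "d u x \<ge> d a x" "d v x \<ge> d a x"
  shows "(a, x) \<in> {(y, z). E y z \<and> {y, z} \<noteq> {u, v}}\<^sup>*"
  using assms
proof (induction "d a x" arbitrary: a)
  case 0
  then show ?case using d_eq_0[of a x] by auto
next
  case (Suc n)
  then obtain z where z: "E a z" "d a x = Suc (d z x)"
    using closer_neighbour[of a x] wdist_refl[of x] by (metis nat.distinct(1))
  have "{a, z} \<noteq> {u, v}" using Suc z by (auto simp: doubleton_eq_iff)
  moreover have "(z, x) \<in> {(y, z). E y z \<and> {y, z} \<noteq> {u, v}}\<^sup>*"
    using Suc z E_in[OF z(1)] by (intro Suc.hyps) auto
  ultimately show ?case using z(1) by (intro converse_rtrancl_into_rtrancl[of a z]) auto
qed

lemma rtrancl_undirected: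
  assumes "(x, y) \<in> {(x, y). E x y \<and> {x, y} \<noteq> {a, b}}\<^sup>*"
  shows "(y, x) \<in> {(x, y). E x y \<and> {x, y} \<noteq> {a, b}}\<^sup>*"
proof -
  have "sym {(x, y). E x y \<and> {x, y} \<noteq> {a, b}}"
    using E_sym by (auto simp: sym_def insert_commute)
  from symD[OF sym_rtrancl[OF this] assms] show ?thesis .
qed

text \<open>With equal distances, the geodesics from \<open>a\<close> and from \<open>b\<close> to
  \<open>x\<close> would both avoid the edge and, joined at \<open>x\<close>, bypass a
  bridge.\<close>

lemma edge_dist:
  assumes "E a b" "x \<in> V"
  shows "d x a = Suc (d x b) \<or> d x b = Suc (d x a)"
proof (rule ccontr)
  assume "\<not> ?thesis"
  moreover have "d x b \<le> Suc (d x a)" "d x a \<le> Suc (d x b)"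
    using d_edge_le[of a b x] d_edge_le[of b a x] E_sym assms by auto
  ultimately have "d a x = d b x" using d_sym[of x] E_in[OF assms(1)] assms by auto
  then have "(a, x) \<in> {(x, y). E x y \<and> {x, y} \<noteq> {a, b}}\<^sup>*"
    and "(b, x) \<in> {(x, y). E x y \<and> {x, y} \<noteq> {a, b}}\<^sup>*"
    using E_in[OF assms(1)] E_neq[OF assms(1)] assms(2) by (auto intro!: geodesic_avoids)
  then show False using bridge[OF assms(1)] rtrancl_undirected[of b x] by (meson rtrancl_trans)
qed

text \<open>Otherwise the route from \<open>a\<close> to \<open>x\<close>, back to \<open>b\<close>
  and on to \<open>t\<close> would bypass the edge from \<open>a\<close> to
  \<open>t\<close>.\<close>

lemma closer_unique:
  assumes "E a t" "E b t" "x \<in> V" "d x t = Suc (d x a)" "d x t = Suc (d x b)"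
  shows "a = b"
proof (rule ccontr)
  assume ne: "a \<noteq> b"
  note inV = E_in[OF assms(1)] E_in[OF assms(2)]
  have *: "d t x = Suc (d a x)" "d t x = Suc (d b x)" using assms d_sym[of x] inV by auto
  have "(a, x) \<in> {(x, y). E x y \<and> {x, y} \<noteq> {a, t}}\<^sup>*"
    and "(b, x) \<in> {(x, y). E x y \<and> {x, y} \<noteq> {a, t}}\<^sup>*"
    using inV E_neq[OF assms(1)] assms(3) * by (auto intro!: geodesic_avoids)
  then have "(a, b) \<in> {(x, y). E x y \<and> {x, y} \<noteq> {a, t}}\<^sup>*"
    using rtrancl_undirected by (meson rtrancl_trans)
  moreover have "(b, t) \<in> {(x, y). E x y \<and> {x, y} \<noteq> {a, t}}"
    using assms(2) ne E_neq[OF assms(2)] by (auto simp: doubleton_eq_iff)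
  ultimately show False using bridge[OF assms(1)] by (meson rtrancl.rtrancl_into_rtrancl)
qed

text \<open>A geodesic that leaves \<open>x\<close> across an edge cannot turn back: the only
  neighbour of \<open>b\<close> nearer to \<open>x\<close> is \<open>a\<close>, so the next vertex
  \<open>c\<close> towards \<open>y\<close> is farther from \<open>x\<close>, and the edge from
  \<open>b\<close> to \<open>c\<close> takes the role of the given one.\<close>

lemma dist_through_edge:
  assumes "E a b" "x \<in> V" "y \<in> V" "d x b = Suc (d x a)" "d a y = Suc (d b y)"
  shows "d x y = Suc (d x a + d b y)"
  using assms
proof (induction "d b y" arbitrary: a b)
  case 0
  then have "y = b" using d_eq_0[of b y] E_in by auto
  then show ?case using 0 by simp
next
  case (Suc n)
  note inV = E_in[OF \<open>E a b\<close>]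
  obtain c where c: "E b c" "d b y = Suc (d c y)"
    using closer_neighbour[of b y] Suc inV wdist_refl[of b] by (metis nat.distinct(1))
  have "c \<noteq> a" using c Suc.prems by auto
  have xc: "d x c = Suc (d x b)"
    using edge_dist[OF c(1) Suc.prems(2)] closer_unique[OF Suc.prems(1) E_sym[OF c(1)] Suc.prems(2,4)]
      \<open>c \<noteq> a\<close> by metis
  have "d x y = Suc (d x b + d c y)"
    using Suc.hyps(2) c(2) by (intro Suc.hyps(1) c Suc.prems(2,3) xc) simp
  then show ?case using Suc.prems(4) c(2) by simp
qed

text \<open>The equation \<open>d t y = Suc (d b y)\<close> encodes that \<open>y\<close> lies in
  the branch at \<open>t\<close> through \<open>b\<close>. As \<open>x\<close> does not, the
  geodesic between them passes through \<open>t\<close>.\<close>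

lemma dist_decomp:
  assumes "x \<in> V" "y \<in> V" "E t b" "d t y = Suc (d b y)" "d t x \<noteq> Suc (d b x)"
  shows "d x y = d x t + d t y"
proof -
  note inV = E_in[OF assms(3)]
  have "d x b = Suc (d x t)" using edge_dist[OF assms(3,1)] assms d_sym[of x] inV by auto
  from dist_through_edge[OF assms(3,1,2) this assms(4)] show ?thesis using assms(4) by simp
qed

end

subsection \<open>Crossings of a square board\<close>

text \<open>Sup-norm distance at most \<open>k\<close>, written without truncated subtraction.
  \<open>near 1\<close> is adjacency with diagonals allowed.\<close>

definition near :: "nat \<Rightarrow> nat \<times> nat \<Rightarrow> nat \<times> nat \<Rightarrow> bool" where
  "near k u v \<longleftrightarrow> fst u \<le> fst v + k \<and> fst v \<le> fst u + k \<and> snd u \<le> snd v + k \<and> snd v \<le> snd u + k"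

definition reach :: "(nat \<times> nat) set \<Rightarrow> nat \<times> nat \<Rightarrow> nat \<times> nat \<Rightarrow> bool" where
  "reach S u v \<longleftrightarrow> u \<in> S \<and> (u, v) \<in> {(x, y). x \<in> S \<and> y \<in> S \<and> near 1 x y}\<^sup>*"

lemma near_sym: "near k u v \<Longrightarrow> near k v u"
  by (auto simp: near_def)

lemma reach_refl: "u \<in> S \<Longrightarrow> reach S u u"
  by (simp add: reach_def)

lemma reach_step: "reach S u v \<Longrightarrow> near 1 v w \<Longrightarrow> w \<in> S \<Longrightarrow> reach S u w"
  unfolding reach_def 
  by (auto intro!: rtrancl.rtrancl_into_rtrancl[of u v] elim: rtranclE)

lemma reach_in: "reach S u v \<Longrightarrow> u \<in> S \<and> v \<in> S"
  unfolding reach_def by (auto elim: rtranclE)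

lemma reach_induct [consumes 1, case_names refl step]:
  assumes "reach S u v" "u \<in> S \<Longrightarrow> P u"
    and "\<And>x y. reach S u x \<Longrightarrow> near 1 x y \<Longrightarrow> y \<in> S \<Longrightarrow> P x \<Longrightarrow> P y"
  shows "P v"
proof -
  have "(u, v) \<in> {(x, y). x \<in> S \<and> y \<in> S \<and> near 1 x y}\<^sup>*" "u \<in> S"
    using assms(1) unfolding reach_def by auto
  then show ?thesis
  proof (induction rule: rtrancl_induct)
    case (step y z)
    then show ?case using assms(3)[of y z] by (auto simp: reach_def)
  qed (use assms(2) in auto)
qed

lemma reach_trans: "reach S v w \<Longrightarrow> reach S u v \<Longrightarrow> reach S u w"
proof (induction rule: reach_induct)
  case (step x y)
  then show ?case using reach_step[of S u x y] by blast
qed auto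

text \<open>Allows a path to be drawn inside the component of its start, so that every vertex found
  on it is again reachable.\<close>

lemma reach_closure: "reach S u v \<Longrightarrow> reach {w. reach S u w} u v"
proof (induction rule: reach_induct)
  case refl
  then show ?case by (simp add: reach_refl)
next
  case (step x y)
  then show ?case using reach_step[of S u x y] reach_step[of "{w. reach S u w}" u x y] by blast
qed

lemma reach_sym: "reach S u v \<Longrightarrow> reach S v u"
proof (induction rule: reach_induct)
  case (step x y)
  have "reach S y x"
    using reach_step[OF reach_refl[OF step(3)] near_sym[OF step(2)]] reach_in[OF step(1)] by blast
  then show ?case using reach_trans[OF step(4)] by blast
qed (auto intro: reach_refl)

text \<open>Discrete intermediate value theorem: a step changes the first coordinate by at most
  1.\<close>

lemma reach_fst_between:
  assumes "reach S u v" "fst u \<le> i \<and> i \<le> fst v \<or> fst v \<le> i \<and> i \<le> fst u"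
  shows "\<exists>w. reach S u w \<and> fst w = i"
  using assms
proof (induction arbitrary: i rule: reach_induct)
  case refl
  then show ?case using reach_refl[of u S] by (intro exI[of _ u]) auto
next
  case (step x y)
  show ?case
  proof (cases "fst u \<le> i \<and> i \<le> fst x \<or> fst x \<le> i \<and> i \<le> fst u")
    case True
    then show ?thesis using step by blast
  next
    case False
    then have "i = fst y" using step by (auto simp: near_def)
    then show ?thesis using step reach_step by blast
  qed
qed

text \<open>Kuhn's lemma on the board enlarged by a frame. A point of \<open>S\<close> gets the label \<open>(0, 0)\<close> or
  \<open>(1, 1)\<close> according to whether it is reachable from the left inside \<open>S\<close>, and a point outside
  gets \<open>(1, 0)\<close> or \<open>(0, 1)\<close> according to whether it is reachable from the bottom outside \<open>S\<close>. Two
  opposite labels never occur at neighbouring points, so on a unit square one of the two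
  components of the label is constant.\<close>
lemma hex_exists:
  fixes S :: "(nat \<times> nat) set" and n :: nat
  defines "B \<equiv> {1..n} \<times> {1..n}"
  assumes "n \<ge> 1"
  shows "(\<exists>u v. reach (S \<inter> B) u v \<and> fst u = 1 \<and> fst v = n) \<or>
         (\<exists>u v. reach (B - S) u v \<and> snd u = 1 \<and> snd v = n)"
proof (rule ccontr)
  assume contra: "\<not> ?thesis"
  define L where "L = {v. \<exists>u. reach (S \<inter> B) u v \<and> fst u = 1}"
  define D where "D = {v. \<exists>u. reach (B - S) u v \<and> snd u = 1}"
  \<comment> \<open>On the frame each side takes one of its two corners, in cyclic order. This meets
    the boundary conditions of Kuhn's lemma: a component of the label is 0 where its coordinate is
    0, and 1 where it is \<open>n + 1\<close>.\<close>
  define ty :: "nat \<times> nat \<Rightarrow> nat \<times> nat" where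
    "ty v = (if snd v = 0 \<and> fst v > 0 then (1, 0)
      else if fst v = 0 \<and> snd v \<le> n then (0, 0)
      else if snd v = n + 1 \<and> fst v \<le> n then (0, 1)
      else if fst v = n + 1 then (1, 1)
      else if v \<in> S then (if v \<in> L then (0, 0) else (1, 1))
      else if v \<in> D then (1, 0) else (0, 1))" for v
  have ty_cases: "ty v \<in> {(0, 0), (1, 1), (1, 0), (0, 1)}" for v by (auto simp: ty_def)
  have LB: "L \<subseteq> S \<inter> B" "D \<subseteq> B - S" unfolding L_def D_def using reach_in by blast+
  have L_right: "v \<notin> L" if "fst v = n" for v using contra that unfolding L_def by blast
  have D_top: "v \<notin> D" if "snd v = n" for v using contra that unfolding D_def by blast
  have L_left: "v \<in> L" if "v \<in> S" "v \<in> B" "fst v = 1" for v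
    using that reach_refl[of v "S \<inter> B"] unfolding L_def by blast
  have D_bot: "v \<in> D" if "v \<notin> S" "v \<in> B" "snd v = 1" for v
    using that reach_refl[of v "B - S"] unfolding D_def by blast
  have L_step: "w \<in> L" if "v \<in> L" "near 1 v w" "w \<in> S" "w \<in> B" for v w
    using that reach_step unfolding L_def by blast
  have D_step: "w \<in> D" if "v \<in> D" "near 1 v w" "w \<notin> S" "w \<in> B" for v w
    using that reach_step[of "B - S"] unfolding D_def by blast
  have sep: "\<not> (ty v = (0, 0) \<and> ty w = (1, 1))" "\<not> (ty v = (1, 0) \<and> ty w = (0, 1))"
    if "near 1 v w" "fst v \<le> n + 1" "snd v \<le> n + 1" "fst w \<le> n + 1" "snd w \<le> n + 1" for v w
  proof -
    have inB: "x \<in> B \<longleftrightarrow> fst x \<ge> 1 \<and> fst x \<le> n \<and> snd x \<ge> 1 \<and> snd x \<le> n" for x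
      by (auto simp: B_def mem_Times_iff)
    show "\<not> (ty v = (0, 0) \<and> ty w = (1, 1))"
    proof
      assume *: "ty v = (0, 0) \<and> ty w = (1, 1)"
      from * have v: "fst v = 0 \<or> v \<in> L \<and> v \<in> B"
        using LB by (auto simp: ty_def split: if_splits)
      from * that have w: "fst w = n + 1 \<or> w \<in> S \<and> w \<notin> L \<and> w \<in> B"
        by (auto simp: ty_def inB split: if_splits)
      show False using v w that assms(2) L_left[of w] L_right[of v] L_step[of v w]
        by (auto simp: near_def inB)
    qed
    show "\<not> (ty v = (1, 0) \<and> ty w = (0, 1))"
    proof
      assume *: "ty v = (1, 0) \<and> ty w = (0, 1)"
      from * have v: "snd v = 0 \<or> v \<in> D \<and> v \<in> B"
        using LB by (auto simp: ty_def split: if_splits)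
      from * that have w: "snd w = n + 1 \<or> w \<notin> S \<and> w \<notin> D \<and> w \<in> B"
        by (auto simp: ty_def inB split: if_splits)
      show False using v w that assms(2) D_bot[of w] D_top[of v] D_step[of v w]
        by (auto simp: near_def inB)
    qed
  qed
  define label :: "(nat \<Rightarrow> nat) \<Rightarrow> nat \<Rightarrow> nat" where
    "label x i = (if i = 0 then fst (ty (x 0, x 1)) else snd (ty (x 0, x 1)))" for x i
  have lt2: "(\<forall>i<2. P i) \<longleftrightarrow> P 0 \<and> P (1::nat)" for P by (auto simp: less_2_cases_iff)
  obtain q where q: "\<forall>i<2. q i < n + 1"
    "\<forall>i<2. \<exists>r s. (\<forall>j<2. q j \<le> r j \<and> r j \<le> q j + 1) \<and>
        (\<forall>j<2. q j \<le> s j \<and> s j \<le> q j + 1) \<and> label r i \<noteq> label s i"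
  proof (rule kuhn_lemma[of "n + 1" 2 label])
    show "\<forall>x. (\<forall>i<2. x i \<le> n + 1) \<longrightarrow> (\<forall>i<2. label x i = 0 \<or> label x i = 1)"
    proof (intro allI impI)
      fix x :: "nat \<Rightarrow> nat" and i :: nat
      show "label x i = 0 \<or> label x i = 1"
        using ty_cases[of "(x 0, x 1)"] by (auto simp: label_def)
    qed
    show "\<forall>x. (\<forall>i<2. x i \<le> n + 1) \<longrightarrow> (\<forall>i<2. x i = 0 \<longrightarrow> label x i = 0)"
      by (auto simp: lt2 label_def ty_def)
    show "\<forall>x. (\<forall>i<2. x i \<le> n + 1) \<longrightarrow> (\<forall>i<2. x i = n + 1 \<longrightarrow> label x i = 1)"
      using assms(2) by (auto simp: lt2 label_def ty_def)
  qed auto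
  define Q where "Q = {v. q 0 \<le> fst v \<and> fst v \<le> q 0 + 1 \<and> q 1 \<le> snd v \<and> snd v \<le> q 1 + 1}"
  have Q: "\<not> (ty v = (0, 0) \<and> ty w = (1, 1))" "\<not> (ty v = (1, 0) \<and> ty w = (0, 1))"
    if "v \<in> Q" "w \<in> Q" for v w
    using sep[of v w] that q(1) by (auto simp: Q_def near_def lt2)
  obtain r s where rs: "r \<in> Q" "s \<in> Q" "fst (ty r) \<noteq> fst (ty s)"
    using q(2) unfolding lt2 label_def Q_def by fastforce
  obtain r' s' where rs': "r' \<in> Q" "s' \<in> Q" "snd (ty r') \<noteq> snd (ty s')"
    using q(2) unfolding lt2 label_def Q_def by fastforce
  show False
    using rs rs' Q[of r s] Q[of s r] Q[of r r'] Q[of r s'] Q[of r' r] Q[of s' r]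
      Q[of s r'] Q[of s s'] Q[of r' s] Q[of s' s] Q[of r' s'] Q[of s' r']
      ty_cases[of r] ty_cases[of s] ty_cases[of r'] ty_cases[of s']
    by (elim insertE emptyE) simp_all
qed

section \<open>Crossings as polygonal paths in the plane\<close>

abbreviation pt2 :: "nat \<times> nat \<Rightarrow> real^2" where
  "pt2 v \<equiv> vector [real (fst v), real (snd v)]"

lemma reach_path:
  assumes "reach S u v"
  obtains f where "path f" "pathstart f = pt2 u" "pathfinish f = pt2 v"
    "\<And>z. z \<in> path_image f \<Longrightarrow> \<exists>x\<in>S. \<exists>y\<in>S. near 1 x y \<and> z \<in> closed_segment (pt2 x) (pt2 y)"
proof -
  have "\<exists>f. path f \<and> pathstart f = pt2 u \<and> pathfinish f = pt2 v \<and>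
    (\<forall>z\<in>path_image f. \<exists>x\<in>S. \<exists>y\<in>S. near 1 x y \<and> z \<in> closed_segment (pt2 x) (pt2 y))"
    using assms
  proof (induction rule: reach_induct)
    case refl
    show ?case
      by (intro exI[of _ "linepath (pt2 u) (pt2 u)"] conjI path_linepath pathstart_linepath
          pathfinish_linepath) (use refl in \<open>auto simp: near_def intro!: bexI[of _ u]\<close>)
  next
    case (step x y)
    then obtain f where f: "path f" "pathstart f = pt2 u" "pathfinish f = pt2 x"
      "\<forall>z\<in>path_image f. \<exists>x\<in>S. \<exists>y\<in>S. near 1 x y \<and> z \<in> closed_segment (pt2 x) (pt2 y)" by blast
    show ?case
      by (rule exI[of _ "f +++ linepath (pt2 x) (pt2 y)"])
        (use f step reach_in[of S u x] in \<open>auto simp: path_image_join\<close>)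
  qed
  then show ?thesis using that by blast
qed

text \<open>The polygonal paths through the two crossings meet by the Fashoda theorem. Diagonal
  steps may cross without a common vertex, but the meeting point is within sup-distance 1 of a
  vertex of each path, hence \<open>near 2\<close>.\<close>

lemma crossing_paths_meet:
  assumes "reach S u v" "fst u = a" "fst v = b" "reach S' u' v'" "snd u' = a" "snd v' = b"
    and "S \<subseteq> {a..b} \<times> {a..b}" "S' \<subseteq> {a..b} \<times> {a..b}"
  obtains w w' where "reach S u w" "reach S' u' w'" "near 2 w w'"
proof -
  define T where "T = {w. reach S u w}"
  define T' where "T' = {w. reach S' u' w}"
  have rT: "reach T u w" if "reach S u w" for w
    using reach_closure[OF that] by (simp add: T_def)
  have rT': "reach T' u' w" if "reach S' u' w" for w
    using reach_closure[OF that] by (simp add: T'_def)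
  have sub: "T \<subseteq> {a..b} \<times> {a..b}" "T' \<subseteq> {a..b} \<times> {a..b}"
    using assms(7,8) reach_in unfolding T_def T'_def by blast+
  let ?a = "vector [real a, real a] :: real^2" and ?b = "vector [real b, real b] :: real^2"
  obtain f where f: "path f" "pathstart f = pt2 u" "pathfinish f = pt2 v"
    "\<And>z. z \<in> path_image f \<Longrightarrow> \<exists>x\<in>T. \<exists>y\<in>T. near 1 x y \<and> z \<in> closed_segment (pt2 x) (pt2 y)"
    using reach_path[OF rT[OF assms(1)]] by blast
  obtain g where g: "path g" "pathstart g = pt2 u'" "pathfinish g = pt2 v'"
    "\<And>z. z \<in> path_image g \<Longrightarrow> \<exists>x\<in>T'. \<exists>y\<in>T'. near 1 x y \<and> z \<in> closed_segment (pt2 x) (pt2 y)"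
    using reach_path[OF rT'[OF assms(4)]] by blast
  have pt: "pt2 x \<in> cbox ?a ?b" if "x \<in> {a..b} \<times> {a..b}" for x
    using that by (auto simp: mem_box_cart forall_2)
  have seg: "closed_segment (pt2 x) (pt2 y) \<subseteq> cbox ?a ?b"
    if "x \<in> {a..b} \<times> {a..b}" "y \<in> {a..b} \<times> {a..b}" for x y
    using pt that by (intro closed_segment_subset) auto
  obtain z where z: "z \<in> path_image f" "z \<in> path_image g"
  proof (rule fashoda[OF f(1) g(1), of ?a ?b])
    show "path_image f \<subseteq> cbox ?a ?b" "path_image g \<subseteq> cbox ?a ?b" using f(4) g(4) seg sub by blast+
  qed (use f g assms in auto)
  have close: "\<bar>z $ 1 - fst x\<bar> \<le> 1" "\<bar>z $ 2 - snd x\<bar> \<le> 1"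
    if z: "z \<in> closed_segment (pt2 x) (pt2 y)" and near: "near 1 x y" for x y
  proof -
    have *: "\<bar>(1 - t) * p + t * q - p\<bar> \<le> 1" if "0 \<le> t" "t \<le> 1" "\<bar>q - p\<bar> \<le> 1" for t p q :: real
    proof -
      have "(1 - t) * p + t * q - p = t * (q - p)" by (simp add: algebra_simps)
      then show ?thesis using mult_mono[of t 1 "\<bar>q - p\<bar>" 1] that by (simp add: abs_mult)
    qed
    obtain t where t: "0 \<le> t" "t \<le> 1" "z = (1 - t) *\<^sub>R pt2 x + t *\<^sub>R pt2 y"
      using z by (auto simp: in_segment)
    have "\<bar>real (fst y) - fst x\<bar> \<le> 1" "\<bar>real (snd y) - snd x\<bar> \<le> 1"
      using near by (auto simp: near_def)
    then show "\<bar>z $ 1 - fst x\<bar> \<le> 1" "\<bar>z $ 2 - snd x\<bar> \<le> 1"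
      using * t by auto
  qed
  obtain x y where xy: "x \<in> T" "near 1 x y" "z \<in> closed_segment (pt2 x) (pt2 y)" using f(4)[OF z(1)] by blast
  obtain x' y' where xy': "x' \<in> T'" "near 1 x' y'" "z \<in> closed_segment (pt2 x') (pt2 y')" using g(4)[OF z(2)] by blast
  have "near 2 x x'" using close[OF xy(3,2)] close[OF xy'(3,2)] by (auto simp: near_def)
  with xy xy' show ?thesis using that by (auto simp: T_def T'_def)
qed

subsection \<open>Fibres of maps from a board to a tree\<close>

lemma near_midpoint:
  assumes "near 2 u v" "u \<in> {1..n} \<times> {1..n}" "v \<in> {1..n} \<times> {1..n}"
  obtains m where "m \<in> {1..n} \<times> {1..n}" "near 1 u m" "near 1 m v"
proof
  show "((fst u + fst v) div 2, (snd u + snd v) div 2) \<in> {1..n} \<times> {1..n}"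
    using assms by (auto simp: mem_Times_iff)
qed (use assms(1) in \<open>auto simp: near_def\<close>)

context tree
begin

text \<open>If no thickened fibre \<open>A t\<close> crosses the board, its complement crosses it in both directions,
  inside the preimage of a single branch at \<open>t\<close>. Following these branches from vertex to
  vertex one must turn back along some edge, which yields disjoint crossings in both directions.\<close>
lemma fibre_crossing:
  fixes F :: "nat \<times> nat \<Rightarrow> 'a" and n D :: nat
  assumes "n \<ge> 1" "V \<noteq> {}" and F: "\<And>u. u \<in> {1..n} \<times> {1..n} \<Longrightarrow> F u \<in> V"
    and lip: "\<And>u v. u \<in> {1..n} \<times> {1..n} \<Longrightarrow> v \<in> {1..n} \<times> {1..n} \<Longrightarrow> near 1 u v \<Longrightarrow> d (F u) (F v) \<le> D"
  obtains t u v where "t \<in> V" "reach {w \<in> {1..n} \<times> {1..n}. d t (F w) \<le> 2 * D} u v"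
    "fst u = 1 \<and> fst v = n \<or> snd u = 1 \<and> snd v = n"
proof (rule ccontr)
  assume contra: "\<not> thesis"
  note crossing = that
  define B where "B = {1..n} \<times> {1..n}"
  define A where "A t = {w \<in> B. d t (F w) \<le> 2 * D}" for t
  have no: "\<not> (reach (A t) u v \<and> (fst u = 1 \<and> fst v = n \<or> snd u = 1 \<and> snd v = n))"
    if "t \<in> V" for t u v
    using contra crossing[OF that, of u v] unfolding A_def B_def by blast
  have lip2: "d (F u) (F v) \<le> 2 * D" if uv: "u \<in> B" "v \<in> B" "near 2 u v" for u v
  proof -
    obtain m where "m \<in> B" "near 1 u m" "near 1 m v"
      using near_midpoint[OF uv(3)] uv(1,2) unfolding B_def by blast
    then show ?thesis using d_triangle[of "F u" "F m" "F v"] lip[of u m] lip[of m v] F uv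
      unfolding B_def by fastforce
  qed
  \<comment> \<open>The whole component of \<open>u\<close> outside the fibre of \<open>t\<close>
    maps into the branch at \<open>t\<close> through \<open>b\<close>.\<close>
  define br where "br t b u \<longleftrightarrow> (\<forall>w. reach (B - A t) u w \<longrightarrow> d t (F w) = Suc (d b (F w)))" for t b u
  \<comment> \<open>Two such points in different branches would have images more than
    \<open>2 * D\<close> apart, because both images are that far from \<open>t\<close>; the
    thickness of \<open>A t\<close> is chosen for this.\<close>
  have same: "d t (F w') = Suc (d b (F w'))"
    if "t \<in> V" "w \<in> B - A t" "w' \<in> B - A t" "near 2 w w'" "E t b" "d t (F w) = Suc (d b (F w))"
    for t b w w'
  proof (rule ccontr)
    assume "\<not> ?thesis"
    then have "d (F w') (F w) = d (F w') t + d t (F w)"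
      using that F unfolding B_def by (intro dist_decomp) auto
    moreover have "d (F w') (F w) \<le> 2 * D" using that by (intro lip2) (auto simp: near_sym)
    ultimately show False using that(2) by (auto simp: A_def)
  qed
  have br_init: "br t b u" if "t \<in> V" "E t b" "d t (F w) = Suc (d b (F w))" "reach (B - A t) u w" for t b u w
    unfolding br_def
  proof (intro allI impI)
    fix w' assume "reach (B - A t) u w'"
    then have "reach (B - A t) w w'" using reach_trans reach_sym that(4) by blast
    then show "d t (F w') = Suc (d b (F w'))"
    proof (induction rule: reach_induct)
      case (step x y)
      have "near 2 x y" using step(2) by (auto simp: near_def)
      with step that(1,2) reach_in[OF step(1)] show ?case by (intro same[of t x y]) auto
    qed (rule that(3))
  qed
  have "\<exists>b. E t b \<and> (\<exists>u v. reach (B - A t) u v \<and> fst u = 1 \<and> fst v = n \<and> br t b u) \<and>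
      (\<exists>u v. reach (B - A t) u v \<and> snd u = 1 \<and> snd v = n \<and> br t b u)" if t: "t \<in> V" for t
  proof -
    \<comment> \<open>\<open>hex_exists\<close> is used for \<open>A t\<close> and for its
      complement: as \<open>A t\<close> crosses in neither direction, its complement crosses in
      both.\<close>
    have "B - (- A t) = A t" "- A t \<inter> B = B - A t" "A t \<inter> B = A t" by (auto simp: A_def)
    then obtain u v u' v' where LR: "reach (B - A t) u v" "fst u = 1" "fst v = n"
      and TB: "reach (B - A t) u' v'" "snd u' = 1" "snd v' = n"
      using hex_exists[OF assms(1), of "A t"] hex_exists[OF assms(1), of "- A t"] no[OF t]
      unfolding B_def[symmetric] by metis
    obtain w w' where w: "reach (B - A t) u w" "reach (B - A t) u' w'" "near 2 w w'"
      by (rule crossing_paths_meet[OF LR TB]) (auto simp: B_def)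
    have inB: "w \<in> B - A t" "w' \<in> B - A t" using reach_in w by blast+
    then have "t \<noteq> F w" using t wdist_refl[OF t, of E] by (auto simp: A_def)
    then obtain b where b: "E t b" "d t (F w) = Suc (d b (F w))"
      using closer_neighbour[of t "F w"] t F inB unfolding B_def by blast
    then have "d t (F w') = Suc (d b (F w'))" using same[OF t inB w(3)] by blast
    then have "br t b u" "br t b u'" using br_init[OF t b(1)] b(2) w by blast+
    then show ?thesis using b(1) LR TB by blast
  qed
  then obtain \<beta> where \<beta>: "\<And>t. t \<in> V \<Longrightarrow> E t (\<beta> t)"
    and LR: "\<And>t. t \<in> V \<Longrightarrow> \<exists>u v. reach (B - A t) u v \<and> fst u = 1 \<and> fst v = n \<and> br t (\<beta> t) u"
    and TB: "\<And>t. t \<in> V \<Longrightarrow> \<exists>u v. reach (B - A t) u v \<and> snd u = 1 \<and> snd v = n \<and> br t (\<beta> t) u"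
    by metis
  obtain t0 where t0: "t0 \<in> V" using assms(2) by blast
  \<comment> \<open>The chosen branch at \<open>t\<close> points away from the root
    \<open>t0\<close>. That branch contains image points, which are farther from \<open>t0\<close>
    than \<open>t\<close>, so the finite board bounds \<open>d t0 t\<close> and a farthest such
    \<open>t\<close> exists.\<close>
  define G where "G t \<longleftrightarrow> t \<in> V \<and> d t0 (\<beta> t) = Suc (d t0 t)" for t
  have Gt0: "G t0" using edge_dist[OF \<beta>[OF t0] t0] wdist_refl[OF t0, of E] t0 by (auto simp: G_def)
  have bound: "d t0 t \<le> Max ((\<lambda>w. d t0 (F w)) ` B)" if "G t" for t
  proof -
    have t: "t \<in> V" using that by (simp add: G_def)
    obtain u v where u: "reach (B - A t) u v" "br t (\<beta> t) u" using LR[OF t] by blast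
    have uB: "u \<in> B - A t" using reach_in u by blast
    have "d t (F u) = Suc (d (\<beta> t) (F u))" using u(2) reach_refl[OF uB] unfolding br_def by blast
    then have "d t0 (F u) = Suc (d t0 t + d (\<beta> t) (F u))"
      using that uB F \<beta>[OF t] t0 by (intro dist_through_edge) (auto simp: G_def B_def)
    moreover have "d t0 (F u) \<le> Max ((\<lambda>w. d t0 (F w)) ` B)"
      using uB by (intro Max_ge) (auto simp: B_def)
    ultimately show ?thesis by simp
  qed
  have "\<forall>s. G s \<longrightarrow> d t0 s < Suc (Max ((\<lambda>w. d t0 (F w)) ` B))" using bound by (simp add: less_Suc_eq_le)
  from ex_has_greatest_nat[OF Gt0 this] obtain t
    where t: "G t" and tmax: "\<And>s. G s \<Longrightarrow> d t0 s \<le> d t0 t" by blast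
  define t' where "t' = \<beta> t"
  have tV: "t \<in> V" and tt': "E t t'" "d t0 t' = Suc (d t0 t)" using t \<beta> by (auto simp: G_def t'_def)
  have t'V: "t' \<in> V" using E_in[OF tt'(1)] by blast
  have "\<not> G t'" using tmax[of t'] tt' by auto
  \<comment> \<open>By maximality the branch chosen at \<open>t'\<close> points towards the root,
    and the only neighbour of \<open>t'\<close> in that direction is \<open>t\<close>. This is the
    edge where the branches turn back.\<close>
  then have "d t0 t' = Suc (d t0 (\<beta> t'))" using edge_dist[OF \<beta>[OF t'V] t0] t'V by (auto simp: G_def)
  then have \<beta>t': "\<beta> t' = t"
    using closer_unique[OF tt'(1) E_sym[OF \<beta>[OF t'V]] t0] tt'(2) by metis
  obtain u v where u: "reach (B - A t) u v" "fst u = 1" "fst v = n" "br t t' u"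
    using LR[OF tV] t'_def by blast
  obtain u' v' where u': "reach (B - A t') u' v'" "snd u' = 1" "snd v' = n" "br t' t u'"
    using TB[OF t'V] \<beta>t' by auto
  obtain w w' where w: "reach (B - A t) u w" "reach (B - A t') u' w'" "near 2 w w'"
    by (rule crossing_paths_meet[OF u(1,2,3) u'(1,2,3)]) (auto simp: B_def)
  have inB: "w \<in> B - A t" "w' \<in> B - A t'" using reach_in w by blast+
  then have FV: "F w \<in> V" "F w' \<in> V" using F by (auto simp: B_def)
  have 1: "d t (F w) = Suc (d t' (F w))" "d t' (F w') = Suc (d t (F w'))"
    using u(4) u'(4) w unfolding br_def by blast+
  then have "d (F w') (F w) = Suc (d (F w') t + d t' (F w))"
    using tt'(1) FV d_sym tV t'V by (intro dist_through_edge) auto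
  moreover have "d (F w') (F w) \<le> 2 * D" using lip2[of w' w] inB near_sym[OF w(3)] by blast
  moreover have "d t' (F w') > 2 * D" using inB by (auto simp: A_def)
  moreover have "d (F w') t = d t (F w')" using d_sym FV tV by blast
  ultimately show False using 1 by linarith
qed

end

subsection \<open>Regular maps from the hyperbolic plane\<close>

text \<open>\<open>arcosh y\<close> is at most \<open>ln (2 * y)\<close>, and the hypothesis bounds
  \<open>y\<close> by \<open>1 + q / 2\<close>. In this form distance estimates reduce to polynomial
  inequalities.\<close>

lemma hdist_le:
  assumes "Im z > 0" "Im w > 0" "(Re z - Re w)\<^sup>2 + (Im z - Im w)\<^sup>2 \<le> q * (Im z * Im w)"
  shows "hdist z w \<le> ln (2 + q)"
proof -
  define y where "y = 1 + (cmod (z - w))\<^sup>2 / (2 * Im z * Im w)"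
  have "(cmod (z - w))\<^sup>2 \<le> q * (Im z * Im w)" using assms(3) by (simp add: cmod_power2)
  then have "(cmod (z - w))\<^sup>2 / (2 * Im z * Im w) \<le> q / 2"
    using assms(1,2) by (simp add: field_simps)
  then have y: "1 \<le> y" "y \<le> 1 + q / 2" using assms(1,2) by (auto simp: y_def)
  have "sqrt (y\<^sup>2 - 1) \<le> y" using y by (intro real_le_lsqrt) auto
  moreover have "sqrt (y\<^sup>2 - 1) \<ge> 0" using y by (simp add: power2_ge_1_iff)
  ultimately have "0 < y + sqrt (y\<^sup>2 - 1)" "y + sqrt (y\<^sup>2 - 1) \<le> 2 + q" using y by linarith+
  then have "ln (y + sqrt (y\<^sup>2 - 1)) \<le> ln (2 + q)" by simp
  then show ?thesis using y by (simp add: hdist_def arcosh_real_def flip: y_def)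
qed

text \<open>Since \<open>cosh 1\<close> is at most 2, the squared Euclidean distance is below
  \<open>2 * Im w * Im z\<close>. This first gives \<open>Im w < 4 * Im z\<close> and then a squared
  horizontal distance below 8, hence below 9, times the square of \<open>Im z\<close>.\<close>

lemma hdist_less_1:
  assumes "Im z > 0" "Im w > 0" "hdist w z < 1"
  shows "\<bar>Re w - Re z\<bar> < 3 * Im z"
proof -
  define y where "y = 1 + (cmod (w - z))\<^sup>2 / (2 * Im w * Im z)"
  have y: "1 \<le> y" using assms(1,2) by (auto simp: y_def)
  have "cosh (arcosh y) < cosh 1"
    using assms(3) y by (subst cosh_real_nonneg_less_iff) (auto simp: hdist_def y_def)
  moreover have "cosh 1 \<le> (2 :: real)"
  proof -
    have "exp (- 1) \<le> (1 :: real)" by simp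
    then have "exp 1 + exp (- 1) \<le> (4 :: real)" using exp_le by linarith
    then show ?thesis by (simp add: cosh_def)
  qed
  ultimately have "y < 2" using y by simp
  then have "(cmod (w - z))\<^sup>2 < 2 * Im w * Im z" using assms(1,2) by (simp add: y_def field_simps)
  then have *: "(Re w - Re z)\<^sup>2 + (Im w - Im z)\<^sup>2 < 2 * Im w * Im z" by (simp add: cmod_power2)
  have "Im w < 4 * Im z"
  proof (rule ccontr)
    assume "\<not> Im w < 4 * Im z"
    then have "Im w * (Im w - 4 * Im z) \<ge> 0" using assms by simp
    moreover have "(Im w - Im z)\<^sup>2 = Im w * (Im w - 4 * Im z) + 2 * Im w * Im z + (Im z)\<^sup>2"
      by (simp add: power2_eq_square algebra_simps)
    ultimately show False using * by (smt (verit) zero_le_power2)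
  qed
  then have "2 * Im w * Im z < 8 * (Im z * Im z)" using assms(1) by simp
  moreover have "0 \<le> (Im w - Im z)\<^sup>2" "0 < Im z * Im z" using assms(1) by auto
  ultimately have "(Re w - Re z)\<^sup>2 < 9 * (Im z * Im z)" using * by linarith
  then have "\<bar>Re w - Re z\<bar>\<^sup>2 < (3 * Im z)\<^sup>2" by (simp add: power2_eq_square)
  then show ?thesis by (rule power2_less_imp_less) (use assms(1) in simp)
qed

section \<open>Counting points of thickened fibres\<close>

lemma card_le_diameter_int:
  fixes N :: "'c \<Rightarrow> int"
  assumes "finite S" "inj_on N S" "\<And>x y. x \<in> S \<Longrightarrow> y \<in> S \<Longrightarrow> \<bar>N x - N y\<bar> \<le> int k"
  shows "card S \<le> 2 * k + 1"
proof (cases "S = {}")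
  case False
  then obtain x where x: "x \<in> S" by blast
  have "card S = card (N ` S)" using assms(2) by (simp add: card_image)
  also have "\<dots> \<le> card {N x - int k..N x + int k}"
    using assms(3)[OF x] by (intro card_mono) force+
  finally show ?thesis by simp
qed simp

lemma card_le_diameter_nat:
  fixes A :: "nat set"
  assumes "finite A" "\<And>x y. x \<in> A \<Longrightarrow> y \<in> A \<Longrightarrow> real y - real x \<le> L" "L \<ge> 0"
  shows "real (card A) \<le> L + 1"
proof (cases "A = {}")
  case False
  have "card A \<le> card {Min A..Max A}" using assms(1) False by (intro card_mono) auto
  moreover have "Min A \<le> Max A" using assms(1) False by simp
  ultimately have "real (card A) \<le> real (Max A) - real (Min A) + 1" by simp
  then show ?thesis using assms(2)[of "Min A" "Max A"] assms(1) False by simp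
qed (use assms in simp)

lemma summable_poly_half: "summable (\<lambda>j. (1 + real j) ^ D * (1 / 2) ^ j)"
proof (rule summable_comparison_test_bigo)
  show "summable (\<lambda>j. norm ((3 / 4 :: real) ^ j))" by (simp add: summable_geometric)
  show "(\<lambda>j. (1 + real j) ^ D * (1 / 2) ^ j) \<in> O(\<lambda>j. (3 / 4) ^ j)" by real_asymp
qed

text \<open>Distances in the target are integers, so an open unit ball about a vertex is a single
  point; condition (ii) becomes the bound \<open>f_fibre\<close> on exact fibres. The growth
  exponent is rounded to a natural number \<open>D\<close>.\<close>

locale H2_map = tree VT ET
  for VT :: "'a set" and ET :: "'a \<Rightarrow> 'a \<Rightarrow> bool" +
  fixes dZ :: "'b \<Rightarrow> 'b \<Rightarrow> real" and VZ :: "'b set" and f :: "complex \<Rightarrow> 'a \<times> 'b"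
    and \<kappa> C :: real and D :: nat
  assumes degree_le: "\<And>v. v \<in> VT \<Longrightarrow> finite {w \<in> VT. ET v w} \<and> card {w \<in> VT. ET v w} \<le> 3"
    and dZ_nonneg: "\<And>x y. dZ x y \<ge> 0"
    and C_pos: "C > 0"
    and growth: "\<And>z r. z \<in> VZ \<Longrightarrow> r \<ge> 0 \<Longrightarrow>
      finite {v \<in> VZ. dZ z v \<le> r} \<and> real (card {v \<in> VZ. dZ z v \<le> r}) \<le> C * (1 + r) ^ D"
    and \<kappa>_pos: "\<kappa> > 0"
    and f_in: "\<And>z. Im z > 0 \<Longrightarrow> fst (f z) \<in> VT \<and> snd (f z) \<in> VZ"
    and f_lip: "\<And>z w. Im z > 0 \<Longrightarrow> Im w > 0 \<Longrightarrow>
      real (d (fst (f z)) (fst (f w))) + dZ (snd (f z)) (snd (f w)) \<le> \<kappa> * (1 + hdist z w)"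
    and f_fibre: "\<And>z. Im z > 0 \<Longrightarrow> \<exists>Cs. finite Cs \<and> Cs \<subseteq> H2 \<and> real (card Cs) \<le> \<kappa> \<and>
      {x \<in> H2. f x = f z} \<subseteq> (\<Union>c\<in>Cs. {x \<in> H2. hdist c x < 1})"
begin

abbreviation g where "g z \<equiv> fst (f z)"

lemma f_lip_ln:
  assumes "Im z > 0" "Im w > 0" "(Re z - Re w)\<^sup>2 + (Im z - Im w)\<^sup>2 \<le> q * (Im z * Im w)"
  shows "real (d (g z) (g w)) \<le> \<kappa> * (1 + ln (2 + q))"
    and "dZ (snd (f z)) (snd (f w)) \<le> \<kappa> * (1 + ln (2 + q))"
proof -
  have "\<kappa> * (1 + hdist z w) \<le> \<kappa> * (1 + ln (2 + q))"
    using hdist_le[OF assms] \<kappa>_pos by simp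
  then show "real (d (g z) (g w)) \<le> \<kappa> * (1 + ln (2 + q))"
    and "dZ (snd (f z)) (snd (f w)) \<le> \<kappa> * (1 + ln (2 + q))"
    using f_lip[OF assms(1,2)] dZ_nonneg[of "snd (f z)" "snd (f w)"] by linarith+
qed

text \<open>Points of \<open>S\<close> in one hyperbolic unit ball lie within
  \<open>3 * \<eta>\<close> of its centre horizontally, so their column numbers differ by at most 6.
  This leaves at most 13 points for each of at most \<open>\<kappa>\<close> balls.\<close>

lemma fibre_card:
  assumes "finite S" "\<eta> > 0" "\<And>z. z \<in> S \<Longrightarrow> 0 < Im z \<and> Im z \<le> \<eta>"
    and "inj_on (\<lambda>z. \<lfloor>Re z / \<eta>\<rfloor>) S" "z0 \<in> S"
  shows "real (card {z \<in> S. f z = f z0}) \<le> 13 * \<kappa>"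
proof -
  obtain Cs where Cs: "finite Cs" "Cs \<subseteq> H2" "real (card Cs) \<le> \<kappa>"
    "{x \<in> H2. f x = f z0} \<subseteq> (\<Union>c\<in>Cs. {x \<in> H2. hdist c x < 1})"
    using f_fibre[of z0] assms(3)[OF assms(5)] by blast
  have "{z \<in> S. f z = f z0} \<subseteq> (\<Union>c\<in>Cs. {z \<in> S. hdist c z < 1})"
  proof
    fix z assume z: "z \<in> {z \<in> S. f z = f z0}"
    then have "z \<in> {x \<in> H2. f x = f z0}" using assms(3) by (simp add: H2_def)
    then show "z \<in> (\<Union>c\<in>Cs. {z \<in> S. hdist c z < 1})" using Cs(4) z by blast
  qed
  then have "card {z \<in> S. f z = f z0} \<le> card (\<Union>c\<in>Cs. {z \<in> S. hdist c z < 1})"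
    using Cs(1) assms(1) by (intro card_mono) auto
  also have "\<dots> \<le> (\<Sum>c\<in>Cs. card {z \<in> S. hdist c z < 1})" by (rule card_UN_le[OF Cs(1)])
  also have "\<dots> \<le> (\<Sum>c\<in>Cs. 13)"
  proof (rule sum_mono)
    fix c assume "c \<in> Cs"
    then have c: "Im c > 0" using Cs(2) by (auto simp: H2_def)
    have near: "\<bar>Re c - Re z\<bar> < 3 * \<eta>" if "z \<in> S" "hdist c z < 1" for z
      using hdist_less_1[of z c] assms(3)[OF that(1)] c that(2) by auto
    have "card {z \<in> S. hdist c z < 1} \<le> 2 * 6 + 1"
    proof (rule card_le_diameter_int)
      show "inj_on (\<lambda>z. \<lfloor>Re z / \<eta>\<rfloor>) {z \<in> S. hdist c z < 1}"
        by (rule inj_on_subset[OF assms(4)]) auto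
    next
      fix x y assume *: "x \<in> {z \<in> S. hdist c z < 1}" "y \<in> {z \<in> S. hdist c z < 1}"
      have "\<bar>Re x - Re y\<bar> < 6 * \<eta>" using near[of x] near[of y] * by auto
      then have "\<bar>Re x / \<eta> - Re y / \<eta>\<bar> < 6" using assms(2) by (simp add: field_simps flip: diff_divide_distrib)
      then show "\<bar>\<lfloor>Re x / \<eta>\<rfloor> - \<lfloor>Re y / \<eta>\<rfloor>\<bar> \<le> int 6" by linarith
    qed (use assms(1) in auto)
    then show "card {z \<in> S. hdist c z < 1} \<le> 13" by simp
  qed
  finally have "card {z \<in> S. f z = f z0} \<le> card Cs * 13" by simp
  then have "real (card {z \<in> S. f z = f z0}) \<le> real (card Cs * 13)" by (subst of_nat_le_iff)
  also have "\<dots> \<le> 13 * \<kappa>" using Cs(3) by simp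
  finally show ?thesis .
qed

text \<open>\<open>f\<close> maps \<open>S\<close> into the product of a ball of radius
  \<open>s\<close> in the tree and a ball in \<open>Z\<close> whose radius is logarithmic in
  \<open>L\<close>, with fibres of at most \<open>13 * \<kappa>\<close> points. So the Euclidean
  width \<open>L\<close> enters only through \<open>ln\<close>, to the power
  \<open>D\<close>.\<close>

lemma level_card:
  assumes "finite S" "\<eta> > 0" "\<And>z. z \<in> S \<Longrightarrow> \<eta> / 2 \<le> Im z \<and> Im z \<le> \<eta>"
    and "inj_on (\<lambda>z. \<lfloor>Re z / \<eta>\<rfloor>) S" "\<And>z w. z \<in> S \<Longrightarrow> w \<in> S \<Longrightarrow> \<bar>Re z - Re w\<bar> \<le> L * \<eta>"
    and "t \<in> VT" "\<And>z. z \<in> S \<Longrightarrow> d t (g z) \<le> s"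
  shows "real (card S) \<le> 13 * \<kappa> * 4 ^ s * C * (1 + \<kappa> * (1 + ln (3 + 4 * L\<^sup>2))) ^ D"
proof (cases "S = {}")
  case True
  have "ln (3 + 4 * L\<^sup>2) \<ge> 0" by (intro ln_ge_zero) (simp add: add_increasing2)
  then show ?thesis using True \<kappa>_pos C_pos by simp
next
  case False
  then obtain z0 where z0: "z0 \<in> S" by blast
  have pos: "Im z > 0" if "z \<in> S" for z using assms(2) assms(3)[OF that] by linarith
  define \<rho> where "\<rho> = \<kappa> * (1 + ln (3 + 4 * L\<^sup>2))"
  have "ln (3 + 4 * L\<^sup>2) \<ge> 0" by (intro ln_ge_zero) (simp add: add_increasing2)
  then have "\<rho> \<ge> 0" using \<kappa>_pos by (simp add: \<rho>_def)
  define BT where "BT = {y \<in> VT. d t y \<le> s}"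
  define BZ where "BZ = {v \<in> VZ. dZ (snd (f z0)) v \<le> \<rho>}"
  have BT: "finite BT" "card BT \<le> 4 ^ s"
    using ball_card_le[OF degree_le assms(6), of s] by (auto simp: BT_def)
  have BZ: "finite BZ" "real (card BZ) \<le> C * (1 + \<rho>) ^ D"
    using growth[of "snd (f z0)" \<rho>] f_in pos z0 \<open>\<rho> \<ge> 0\<close> by (auto simp: BZ_def)
  have "f z \<in> BT \<times> BZ" if z: "z \<in> S" for z
  proof -
    have "(Re z0 - Re z)\<^sup>2 \<le> (L * \<eta>)\<^sup>2"
      using assms(5)[OF z0 z] by (metis abs_ge_zero abs_le_square_iff abs_of_nonneg order_trans)
    moreover have "\<bar>Im z0 - Im z\<bar> \<le> \<bar>\<eta> / 2\<bar>" using assms(3)[OF z] assms(3)[OF z0] by linarith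
    then have "(Im z0 - Im z)\<^sup>2 \<le> (\<eta> / 2)\<^sup>2" by (simp only: abs_le_square_iff)
    ultimately have "(Re z0 - Re z)\<^sup>2 + (Im z0 - Im z)\<^sup>2 \<le> (4 * L\<^sup>2 + 1) * (\<eta> / 2 * (\<eta> / 2))"
      by (simp add: power2_eq_square algebra_simps)
    also have "\<dots> \<le> (4 * L\<^sup>2 + 1) * (Im z0 * Im z)"
      using assms(3)[OF z] assms(3)[OF z0] assms(2) by (intro mult_left_mono mult_mono) auto
    finally have "dZ (snd (f z0)) (snd (f z)) \<le> \<rho>"
      using f_lip_ln(2)[OF pos[OF z0] pos[OF z], of "4 * L\<^sup>2 + 1"] by (simp add: \<rho>_def add.commute)
    then show ?thesis using assms(7)[OF z] f_in[OF pos[OF z]] by (auto simp: BT_def BZ_def mem_Times_iff)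
  qed
  then have "f ` S \<subseteq> BT \<times> BZ" by blast
  then have im: "card (f ` S) \<le> card BT * card BZ"
    unfolding card_cartesian_product[symmetric] using BT(1) BZ(1) by (intro card_mono) auto
  have "real (card S) = (\<Sum>y\<in>f ` S. real (card {z \<in> S. f z = y}))"
    using sum.image_gen[OF assms(1), of "\<lambda>_. 1::real" f] by simp
  also have "\<dots> \<le> (\<Sum>y\<in>f ` S. 13 * \<kappa>)"
    using fibre_card[OF assms(1,2) _ assms(4)] pos assms(3) by (intro sum_mono) auto
  also have "\<dots> = 13 * \<kappa> * card (f ` S)" by simp
  also have "\<dots> \<le> 13 * \<kappa> * (card BT * card BZ)" 
    using im \<kappa>_pos by (simp flip: of_nat_mult)
  also have "\<dots> \<le> 13 * \<kappa> * (4 ^ s * (C * (1 + \<rho>) ^ D))"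
  proof -
    have "real (card BT) \<le> 4 ^ s" using BT(2) by (metis of_nat_le_iff of_nat_numeral of_nat_power)
    then have "real (card BT) * real (card BZ) \<le> 4 ^ s * (C * (1 + \<rho>) ^ D)"
      using BZ(2) by (intro mult_mono) auto
    then show ?thesis using \<kappa>_pos by simp
  qed
  finally show ?thesis by (simp add: \<rho>_def algebra_simps)
qed

text \<open>A chain of points of a thickened fibre that crosses a strip of width \<open>k h\<close> at heights at most
  \<open>h\<close> needs about \<open>2 ^ j k\<close> points at height \<open>h / 2 ^ j\<close> for some \<open>j\<close>, up to a summable
  weight. These points lie within distance \<open>O(j + ln k)\<close> of each other, so by polynomial growth
  there are only \<open>O((j + ln k) ^ D)\<close> of them.\<close>
lemma no_horizontal_crossing:
  obtains k where "k \<ge> 1"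
    "\<And>a h u n R t. 0 < h \<Longrightarrow> 0 < u \<Longrightarrow> u \<le> h / 2 ^ R \<Longrightarrow> k * h \<le> u * real n \<Longrightarrow>
      u * real n \<le> 2 * k * h \<Longrightarrow> t \<in> VT \<Longrightarrow>
      (\<And>i. i \<le> n \<Longrightarrow> \<exists>z. Re z = a + u * real i \<and> h / 2 ^ R \<le> Im z \<and> Im z \<le> h \<and> d t (g z) \<le> s) \<Longrightarrow> False"
proof -
  define M where "M = 13 * \<kappa> * 4 ^ s * C * (1 + 10 * \<kappa>) ^ D"
  have M: "M > 0" using \<kappa>_pos C_pos by (simp add: M_def)
  define Q where "Q = (\<Sum>j. (1 + real j) ^ D * (1 / 2) ^ j)"
  have Qpos: "(\<Sum>j\<le>R. (1 + real j) ^ D * (1 / 2) ^ j) \<le> Q" for R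
    unfolding Q_def by (intro sum_le_suminf summable_poly_half) auto
  \<comment> \<open>The left side times \<open>h / u\<close> will bound the number of columns, of
    which there are more than \<open>k * (h / u)\<close>. The width \<open>k\<close> occurs on the
    left only logarithmically, so a large \<open>k\<close> wins.\<close>
  have "eventually (\<lambda>k. (2 * M * Q) * (2 + ln k) ^ D < k) at_top"
  proof -
    have "(\<lambda>k::real. (2 + ln k) ^ D) \<in> o(\<lambda>k. k)" by real_asymp
    then have "(\<lambda>k::real. (2 * M * Q) * (2 + ln k) ^ D) \<in> o(\<lambda>k. k)" by simp
    from landau_o.smallD[OF this, of "1/2"] have
      "eventually (\<lambda>k. norm ((2 * M * Q) * (2 + ln k) ^ D) \<le> 1/2 * norm k) at_top" by simp
    with eventually_gt_at_top[of 0] show ?thesis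
      by eventually_elim auto
  qed
  then have "eventually (\<lambda>k. k \<ge> 1 \<and> (2 * M * Q) * (2 + ln k) ^ D < k) at_top"
    using eventually_ge_at_top[of 1] by eventually_elim auto
  then obtain k where k: "k \<ge> 1" "(2 * M * Q) * (2 + ln k) ^ D < k"
    unfolding eventually_at_top_linorder by blast
  show ?thesis
  proof (rule that[OF k(1)])
    fix a h u :: real and n R :: nat and t
    assume h: "0 < h" and u: "0 < u" "u \<le> h / 2 ^ R" and n: "k * h \<le> u * real n" "u * real n \<le> 2 * k * h"
      and t: "t \<in> VT"
      and "\<And>i. i \<le> n \<Longrightarrow> \<exists>z. Re z = a + u * real i \<and> h / 2 ^ R \<le> Im z \<and> Im z \<le> h \<and> d t (g z) \<le> s"
    then have "\<forall>i. \<exists>z. i \<le> n \<longrightarrow> Re z = a + u * real i \<and> h / 2 ^ R \<le> Im z \<and> Im z \<le> h \<and> d t (g z) \<le> s"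
      by blast
    then obtain z where z: "\<And>i. i \<le> n \<Longrightarrow> Re (z i) = a + u * real i \<and> h / 2 ^ R \<le> Im (z i) \<and>
        Im (z i) \<le> h \<and> d t (g (z i)) \<le> s" by metis
    have level: "\<exists>j\<le>R. h / 2 ^ j / 2 \<le> y \<and> y \<le> h / 2 ^ j" if "h / 2 ^ R \<le> y" "y \<le> h" for y
      using that(1)
    proof (induction R)
      case 0
      then show ?case using that(2) h by (intro exI[of _ 0]) auto
    next
      case (Suc R)
      then show ?case
        by (cases "h / 2 ^ R \<le> y") (auto intro: le_SucI exI[of _ R] simp: field_simps)
    qed
    have "\<forall>i. \<exists>j. i \<le> n \<longrightarrow> j \<le> R \<and> h / 2 ^ j / 2 \<le> Im (z i) \<and> Im (z i) \<le> h / 2 ^ j"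
      using level z by blast
    then obtain lev where lev: "\<And>i. i \<le> n \<Longrightarrow> lev i \<le> R \<and> h / 2 ^ lev i / 2 \<le> Im (z i) \<and> Im (z i) \<le> h / 2 ^ lev i"
      by metis
    define I where "I j = {i. i \<le> n \<and> lev i = j}" for j
    have I_card: "real (card (I j)) \<le> M * (2 + ln k) ^ D * 2 * (h / u) * ((1 + real j) ^ D * (1 / 2) ^ j)"
      if j: "j \<le> R" for j
    proof -
      define \<eta> where "\<eta> = h / 2 ^ j"
      have \<eta>: "\<eta> > 0" "u \<le> \<eta>"
      proof -
        have "h / 2 ^ R \<le> h / 2 ^ j" using j h by (intro divide_left_mono power_increasing) auto
        then show "\<eta> > 0" "u \<le> \<eta>" using h u by (auto simp: \<eta>_def)
      qed
      define fl where "fl i = \<lfloor>Re (z i) / \<eta>\<rfloor>" for i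
      have finI: "finite (I j)" by (simp add: I_def)
      \<comment> \<open>One index for each occupied column of width \<open>\<eta>\<close>, as
        \<open>level_card\<close> needs distinct columns; the indices sharing a column are counted
        in \<open>fib\<close>.\<close>
      obtain U where U: "U \<subseteq> I j" "inj_on fl U" "fl ` I j = fl ` U"
        using subset_image_inj[of "fl ` I j" fl "I j"] by auto
      have finU: "finite U" using finI U(1) finite_subset by blast
      have injz: "inj_on z U" using U(2) unfolding fl_def inj_on_def by metis
      have Ui: "i \<le> n" "lev i = j" if "i \<in> U" for i using that U(1) by (auto simp: I_def)
      have "real (card (z ` U)) \<le> 13 * \<kappa> * 4 ^ s * C * (1 + \<kappa> * (1 + ln (3 + 4 * (2 * k * 2 ^ j)\<^sup>2))) ^ D"
      proof (rule level_card[OF _ \<eta>(1) _ _ _ t])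
        show "finite (z ` U)" using finU by simp
        show "\<eta> / 2 \<le> Im w \<and> Im w \<le> \<eta>" if "w \<in> z ` U" for w
          using that lev Ui by (auto simp: \<eta>_def)
        show "inj_on (\<lambda>z. \<lfloor>Re z / \<eta>\<rfloor>) (z ` U)"
          using U(2) unfolding fl_def inj_on_def by auto
        show "d t (g w) \<le> s" if "w \<in> z ` U" for w using that z Ui by auto
        show "\<bar>Re w - Re w'\<bar> \<le> 2 * k * 2 ^ j * \<eta>" if "w \<in> z ` U" "w' \<in> z ` U" for w w'
        proof -
          from that obtain i i' where "w = z i" "w' = z i'" "i \<in> U" "i' \<in> U" by auto
          then have i: "w = z i" "w' = z i'" "i \<le> n" "i' \<le> n" using Ui by auto
          have "Re w - Re w' = u * (real i - real i')" using z i by (simp add: algebra_simps)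
          moreover have "\<bar>real i - real i'\<bar> \<le> n" using i by linarith
          ultimately have "\<bar>Re w - Re w'\<bar> \<le> u * n" using u(1) by (simp add: abs_mult)
          then show ?thesis using n(2) by (simp add: \<eta>_def)
        qed
      qed
      \<comment> \<open>Crude constants: 19 is 3 + 16, the bounds 18 and 3 come from
        \<open>ln x \<le> x - 1\<close>, and the factor 10 absorbs them all.\<close>
      also have "\<dots> \<le> 13 * \<kappa> * 4 ^ s * C * ((1 + 10 * \<kappa>) * ((2 + ln k) * (1 + real j))) ^ D"
      proof -
        have k2: "1 \<le> k\<^sup>2 * 4 ^ j" using k(1) by (simp add: one_le_power mult_ge1_I)
        have "3 + 4 * (2 * k * 2 ^ j)\<^sup>2 = 3 + 16 * (k\<^sup>2 * 4 ^ j)"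
        proof -
          have "(2 ^ j)\<^sup>2 = (4 :: real) ^ j"
            by (simp add: power2_eq_square flip: power_mult_distrib)
          then show ?thesis by (simp add: power_mult_distrib)
        qed
        also have "\<dots> \<le> 19 * (k\<^sup>2 * 4 ^ j)" using k2 by simp
        finally have "ln (3 + 4 * (2 * k * 2 ^ j)\<^sup>2) \<le> ln (19 * (k\<^sup>2 * 4 ^ j))"
          using k(1) by (subst ln_le_cancel_iff) (auto simp: add_pos_nonneg)
        also have "\<dots> = ln 19 + 2 * ln k + j * ln 4"
          using k(1) by (simp add: ln_mult ln_realpow)
        also have "\<dots> \<le> 18 + 2 * ln k + j * 3"
        proof -
          have "ln 19 \<le> (18::real)" "ln 4 \<le> (3::real)"
            using ln_le_minus_one[of 19] ln_le_minus_one[of 4] by simp_all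
          then show ?thesis using mult_left_mono[of "ln 4" 3 "real j"] by linarith
        qed
        finally have "1 + ln (3 + 4 * (2 * k * 2 ^ j)\<^sup>2) \<le> 10 * ((2 + ln k) * (1 + real j))"
          using k(1) by (simp add: algebra_simps) (smt (verit) mult_nonneg_nonneg ln_ge_zero of_nat_0_le_iff)
        then have "\<kappa> * (1 + ln (3 + 4 * (2 * k * 2 ^ j)\<^sup>2)) \<le> \<kappa> * (10 * ((2 + ln k) * (1 + real j)))"
          using \<kappa>_pos by (intro mult_left_mono) auto
        moreover have "1 \<le> (2 + ln k) * (1 + real j)" using k(1) by (intro mult_ge1_I) auto
        ultimately have "1 + \<kappa> * (1 + ln (3 + 4 * (2 * k * 2 ^ j)\<^sup>2)) \<le> (1 + 10 * \<kappa>) * ((2 + ln k) * (1 + real j))"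
          by (simp add: algebra_simps)
        moreover have "ln (3 + 4 * (2 * k * 2 ^ j)\<^sup>2) \<ge> 0" by (intro ln_ge_zero) (simp add: add_increasing2)
        ultimately show ?thesis using \<kappa>_pos C_pos by (intro mult_left_mono power_mono) auto
      qed
      also have "\<dots> = M * (2 + ln k) ^ D * (1 + real j) ^ D"
        by (simp add: M_def power_mult_distrib)
      finally have U_card: "real (card U) \<le> M * (2 + ln k) ^ D * (1 + real j) ^ D"
        using injz by (simp add: card_image)
      have fib: "real (card {i \<in> I j. fl i = m}) \<le> 2 * (h / u) * (1 / 2) ^ j" for m
      proof -
        have "real (card {i \<in> I j. fl i = m}) \<le> \<eta> / u + 1"
        proof (rule card_le_diameter_nat)
          fix i i' assume i: "i \<in> {i \<in> I j. fl i = m}" "i' \<in> {i \<in> I j. fl i = m}"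
          then have "Re (z i') / \<eta> - Re (z i) / \<eta> \<le> 1" unfolding fl_def by (simp; linarith)
          then have "Re (z i') - Re (z i) \<le> \<eta>" using \<eta>(1) by (simp add: field_simps)
          moreover have "Re (z i') - Re (z i) = u * (real i' - real i)"
            using z i by (auto simp: I_def algebra_simps)
          ultimately show "real i' - real i \<le> \<eta> / u" using u(1) by (simp add: field_simps)
        qed (use finI \<eta> u in auto)
        also have "\<dots> \<le> 2 * (\<eta> / u)" using \<eta> u(1) by (simp add: field_simps)
        also have "\<dots> = 2 * (h / u) * (1 / 2) ^ j" by (simp add: \<eta>_def power_one_over field_simps)
        finally show ?thesis .
      qed
      have "real (card (I j)) = (\<Sum>m\<in>fl ` I j. real (card {i \<in> I j. fl i = m}))"
        using sum.image_gen[OF finI, of "\<lambda>_. 1::real" fl] by simp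
      also have "\<dots> \<le> (\<Sum>m\<in>fl ` I j. 2 * (h / u) * (1 / 2) ^ j)" by (intro sum_mono fib)
      also have "\<dots> = real (card U) * (2 * (h / u) * (1 / 2) ^ j)" using U by (simp add: card_image)
      also have "\<dots> \<le> (M * (2 + ln k) ^ D * (1 + real j) ^ D) * (2 * (h / u) * (1 / 2) ^ j)"
        using h u by (intro mult_right_mono U_card) auto
      finally show ?thesis by (simp add: algebra_simps)
    qed
    have "{..n} = (\<Union>j\<le>R. I j)" using lev by (auto simp: I_def)
    then have "real (card {..n}) \<le> real (\<Sum>j\<le>R. card (I j))"
      using card_UN_le[of "{..R}" I] by (simp only: of_nat_le_iff finite_atMost)
    also have "\<dots> = (\<Sum>j\<le>R. real (card (I j)))" by simp
    also have "\<dots> \<le> (\<Sum>j\<le>R. M * (2 + ln k) ^ D * 2 * (h / u) * ((1 + real j) ^ D * (1 / 2) ^ j))"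
      by (intro sum_mono I_card) simp
    also have "\<dots> = M * (2 + ln k) ^ D * 2 * (h / u) * (\<Sum>j\<le>R. (1 + real j) ^ D * (1 / 2) ^ j)"
      by (simp add: sum_distrib_left)
    also have "\<dots> \<le> M * (2 + ln k) ^ D * 2 * (h / u) * Q"
      using M k(1) h u by (intro mult_left_mono Qpos) auto
    also have "\<dots> = (2 * M * Q) * (2 + ln k) ^ D * (h / u)" by simp
    also have "\<dots> < k * (h / u)" using k h u by (intro mult_strict_right_mono) auto
    also have "\<dots> \<le> n" using n(1) u by (simp add: field_simps)
    finally show False by simp
  qed
qed

section \<open>Vertical geodesics with bounded image in the tree\<close>

lemma dT_le_nat:
  assumes "Im z > 0" "Im w > 0" "(Re z - Re w)\<^sup>2 + (Im z - Im w)\<^sup>2 \<le> q * (Im z * Im w)"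
  shows "d (g z) (g w) \<le> nat \<lceil>\<kappa> * (1 + ln (2 + q))\<rceil>"
  using f_lip_ln(1)[OF assms] by linarith

text \<open>Excluding horizontal crossings makes some thickened fibre cross the board vertically;
  its lower end determines \<open>x\<close>. The same exclusion applies again at every scale
  \<open>\<eta>\<close>: the part of the crossing below height \<open>\<eta>\<close> cannot drift by
  \<open>k * \<eta>\<close>, so it reaches heights near \<open>\<eta>\<close> at bounded hyperbolic
  distance from the line above \<open>x\<close>.\<close>

lemma vertical_geodesic:
  obtains k c where "k \<ge> 1"
    "\<And>a h R. h > 0 \<Longrightarrow> \<exists>x. a \<le> x \<and> x \<le> a + k * h \<and>
      (\<forall>j\<le>R. d (g (Complex a h)) (g (Complex x (h / 2 ^ j))) \<le> c)"
proof -
  \<comment> \<open>Neighbouring grid points satisfy the distance condition with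
    \<open>q = 2\<close>: 1 for the horizontal and 1 for the vertical displacement.\<close>
  define D0 where "D0 = nat \<lceil>\<kappa> * (1 + ln (2 + 2))\<rceil>"
  obtain k where k: "k \<ge> 1" and no_cross: 
    "\<And>a h u n R t. 0 < h \<Longrightarrow> 0 < u \<Longrightarrow> u \<le> h / 2 ^ R \<Longrightarrow> k * h \<le> u * real n \<Longrightarrow>
      u * real n \<le> 2 * k * h \<Longrightarrow> t \<in> VT \<Longrightarrow>
      (\<And>i. i \<le> n \<Longrightarrow> \<exists>z. Re z = a + u * real i \<and> h / 2 ^ R \<le> Im z \<and> Im z \<le> h \<and> d t (g z) \<le> 2 * D0) \<Longrightarrow> False"
    using no_horizontal_crossing[of "2 * D0"] by blast
  define c1 where "c1 = nat \<lceil>\<kappa> * (1 + ln (2 + (2 * k\<^sup>2 + 1)))\<rceil>"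
  show ?thesis
  proof (rule that[OF k])
    fix a h :: real and R :: nat
    assume h: "h > 0"
    \<comment> \<open>\<open>p\<close> is at least \<open>k * 2 ^ R\<close>, so that the column
      width \<open>u\<close> is at most the lowest height, and at least \<open>R\<close>, so that a
      row step changes the height by a factor of at most 2.\<close>
    define p where "p = nat \<lceil>k * 2 ^ R\<rceil> + R + 1"
    have p: "p \<ge> 1" "real p \<ge> k * 2 ^ R" "p \<ge> R" unfolding p_def by linarith+
    define u where "u = k * h / p"
    have u: "u > 0" "u \<le> h / 2 ^ R" using h k p by (auto simp: u_def field_simps)
    define X where "X w = a + u * (real (fst w) - 1)" for w :: "nat \<times> nat"
    \<comment> \<open>Heights grow geometrically, from \<open>h / 2 ^ R\<close> in row 1 to
      \<open>h\<close> in row \<open>Suc p\<close>; this keeps the board square.\<close>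
    define Y where "Y w = h * 2 powr (- (real R * (real (Suc p) - real (snd w)) / p))" for w :: "nat \<times> nat"
    define B where "B = {1..Suc p} \<times> {1..Suc p}"
    define F where "F w = g (Complex (X w) (Y w))" for w
    have Y_pos: "Y w > 0" for w using h by (simp add: Y_def)
    have Y_range: "h / 2 ^ R \<le> Y w" "Y w \<le> h" if "w \<in> B" for w
    proof -
      have w: "1 \<le> snd w" "snd w \<le> Suc p" using that by (auto simp: B_def mem_Times_iff)
      then have "real R * (real (Suc p) - real (snd w)) / p \<le> real R * p / p"
        by (intro divide_right_mono mult_left_mono) auto
      then have "(2::real) powr (- real R) \<le> 2 powr (- (real R * (real (Suc p) - real (snd w)) / p))"
        using p(1) by (intro powr_mono) auto
      then show "h / 2 ^ R \<le> Y w"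
        using h by (simp add: Y_def powr_minus powr_realpow divide_inverse)
      have "2 powr (- (real R * (real (Suc p) - real (snd w)) / p)) \<le> 2 powr (0::real)"
        using w by (intro powr_mono) auto
      then show "Y w \<le> h" using h by (simp add: Y_def)
    qed
    have Y_step: "Y w \<le> 2 * Y w'" if "near 1 w w'" for w w'
    proof -
      have "real (snd w) \<le> real (snd w') + 1" using that by (auto simp: near_def)
      then have "real R * (real (Suc p) - real (snd w')) / p \<le> real R * (real (Suc p) - real (snd w) + 1) / p"
        by (intro divide_right_mono mult_left_mono) auto
      also have "\<dots> = real R * (real (Suc p) - real (snd w)) / p + real R / p"
        by (simp add: ring_distribs add_divide_distrib diff_divide_distrib)
      also have "real R / p \<le> 1" using p by simp
      finally have "2 powr (- (real R * (real (Suc p) - real (snd w)) / p)) \<le> 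
          2 powr (1 + (- (real R * (real (Suc p) - real (snd w')) / p)))" by (intro powr_mono) auto
      also have "\<dots> = 2 * 2 powr (- (real R * (real (Suc p) - real (snd w')) / p))"
        by (subst powr_add) simp
      finally show ?thesis using h by (simp add: Y_def)
    qed
    have lip: "d (F w) (F w') \<le> D0" if w: "w \<in> B" "w' \<in> B" and near: "near 1 w w'" for w w'
      unfolding F_def D0_def
    proof (rule dT_le_nat)
      have le: "u \<le> Y w" "u \<le> Y w'" using u Y_range[OF w(1)] Y_range[OF w(2)] by auto
      have "X w - X w' = u * (real (fst w) - real (fst w'))" by (simp add: X_def algebra_simps)
      moreover have "\<bar>real (fst w) - real (fst w')\<bar> \<le> 1" using near by (auto simp: near_def)
      ultimately have "\<bar>X w - X w'\<bar> \<le> u"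
        using u(1) mult_left_mono[of "\<bar>real (fst w) - real (fst w')\<bar>" 1 u] by (simp add: abs_mult)
      then have "(X w - X w')\<^sup>2 \<le> u * u" using u(1)
        by (metis abs_le_square_iff abs_of_pos power2_eq_square)
      also have "\<dots> \<le> Y w * Y w'" using le u(1) by (intro mult_mono) auto
      finally have 1: "(X w - X w')\<^sup>2 \<le> Y w * Y w'" .
      have *: "(x - y)\<^sup>2 \<le> x * y" if "0 < x" "x \<le> y" "y \<le> 2 * x" for x y :: real
      proof -
        have "(y - x) * (y - x) \<le> x * y" using that by (intro mult_mono) auto
        then show ?thesis by (simp add: power2_eq_square algebra_simps)
      qed
      have 2: "(Y w - Y w')\<^sup>2 \<le> Y w * Y w'"
        using *[of "Y w" "Y w'"] *[of "Y w'" "Y w"] Y_pos Y_step[OF near] Y_step[OF near_sym[OF near]]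
        by (cases "Y w \<le> Y w'") (auto simp: power2_commute mult.commute)
      show "(Re (Complex (X w) (Y w)) - Re (Complex (X w') (Y w')))\<^sup>2 +
        (Im (Complex (X w) (Y w)) - Im (Complex (X w') (Y w')))\<^sup>2 \<le>
        2 * (Im (Complex (X w) (Y w)) * Im (Complex (X w') (Y w')))"
        using 1 2 by simp
    qed (use Y_pos in auto)
    obtain t v0 v1 where t: "t \<in> VT" and v: "reach {w \<in> B. d t (F w) \<le> 2 * D0} v0 v1"
      "fst v0 = 1 \<and> fst v1 = Suc p \<or> snd v0 = 1 \<and> snd v1 = Suc p"
    proof (rule fibre_crossing[of "Suc p" F D0, folded B_def])
      show "VT \<noteq> {}" using f_in[of \<i>] by auto
      show "F w \<in> VT" for w using f_in[of "Complex (X w) (Y w)"] Y_pos by (simp add: F_def)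
    qed (auto intro: lip)
    define A where "A = {w \<in> B. d t (F w) \<le> 2 * D0}"
    have v: "reach A v0 v1" "fst v0 = 1 \<and> fst v1 = Suc p \<or> snd v0 = 1 \<and> snd v1 = Suc p"
      using v by (auto simp: A_def)
    have "\<not> (fst v0 = 1 \<and> fst v1 = Suc p)"
    proof
      assume LR: "fst v0 = 1 \<and> fst v1 = Suc p"
      show False
      proof (rule no_cross[OF h u, of p t a])
        fix i assume "i \<le> p"
        then obtain w where w: "reach A v0 w" "fst w = Suc i"
          using reach_fst_between[OF v(1), of "Suc i"] LR by auto
        then have "w \<in> B" "d t (F w) \<le> 2 * D0" using reach_in[OF w(1)] by (auto simp: A_def)
        then show "\<exists>z. Re z = a + u * real i \<and> h / 2 ^ R \<le> Im z \<and> Im z \<le> h \<and> d t (g z) \<le> 2 * D0"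
          using Y_range[of w] w(2) by (intro exI[of _ "Complex (X w) (Y w)"]) (auto simp: F_def X_def)
      qed (use t p h k in \<open>auto simp: u_def\<close>)
    qed
    then have TB: "snd v0 = 1" "snd v1 = Suc p" using v(2) by auto
    have v0B: "v0 \<in> B" using reach_in[OF v(1)] by (auto simp: A_def)
    define x where "x = X v0"
    have x: "a \<le> x" "x \<le> a + k * h"
    proof -
      have f: "1 \<le> fst v0" "fst v0 \<le> Suc p" using v0B by (auto simp: B_def mem_Times_iff)
      then have "u * (real (fst v0) - 1) \<le> u * p" using u(1) by (intro mult_left_mono) auto
      moreover have "0 \<le> u * (real (fst v0) - 1)" using f u(1) by simp
      moreover have "u * p = k * h" using p(1) by (simp add: u_def)
      ultimately show "a \<le> x" "x \<le> a + k * h" by (auto simp: x_def X_def)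
    qed
    have near_t: "d t (g (Complex x (h / 2 ^ j))) \<le> 2 * D0 + c1" if j: "j \<le> R" for j
    proof -
      define \<eta> where "\<eta> = h / 2 ^ j"
      have \<eta>: "\<eta> > 0" using h by (simp add: \<eta>_def)
      have \<eta>R: "h / 2 ^ R = \<eta> / 2 ^ (R - j)" "h / 2 ^ R \<le> \<eta>"
      proof -
        have "(2::real) ^ R = 2 ^ j * 2 ^ (R - j)" using j by (simp flip: power_add)
        then show eq: "h / 2 ^ R = \<eta> / 2 ^ (R - j)" by (simp add: \<eta>_def)
        show "h / 2 ^ R \<le> \<eta>" unfolding eq using \<eta> by (simp add: divide_le_eq)
      qed
      \<comment> \<open>A step at most doubles the height, so the crossing cannot jump over the band
        between \<open>\<eta> / 2\<close> and \<open>\<eta>\<close>: it has a point there that is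
        reached from below without exceeding \<open>\<eta>\<close>.\<close>
      define S where "S = {w \<in> A. Y w \<le> \<eta>}"
      have "(\<exists>w. reach S v0 w \<and> \<eta> / 2 \<le> Y w) \<or> reach S v0 v1" using v(1)
      proof (induction rule: reach_induct)
        case refl
        have "real R * (real (Suc p) - real (snd v0)) / p = real R" using TB(1) p(1) by simp
        then have "Y v0 = h / 2 ^ R" unfolding Y_def
          by (simp only:) (simp add: powr_minus powr_realpow divide_inverse)
        then have "v0 \<in> S" using refl \<eta>R(2) by (simp add: S_def)
        then show ?case by (simp add: reach_refl)
      next
        case (step w w')
        show ?case
        proof (cases "reach S v0 w \<and> \<not> \<eta> / 2 \<le> Y w")
          case True
          then have "Y w' \<le> \<eta>" using Y_step[OF near_sym[OF step(2)]] by simp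
          then show ?thesis using True reach_step[OF _ step(2), of S] step(3) by (auto simp: S_def)
        next
          case False
          then show ?thesis using step by blast
        qed
      qed
      moreover have "Y v1 \<ge> \<eta> / 2"
      proof -
        have "Y v1 = h" using TB(2) by (simp add: Y_def)
        moreover have "\<eta> \<le> h" using h by (simp add: \<eta>_def divide_le_eq)
        ultimately show ?thesis using \<eta> by simp
      qed
      ultimately obtain w where w: "reach S v0 w" "\<eta> / 2 \<le> Y w" by blast
      have wA: "w \<in> A" "Y w \<le> \<eta>" using reach_in[OF w(1)] by (auto simp: S_def)
      have "\<bar>X w - x\<bar> < k * \<eta>"
      proof (rule ccontr)
        assume far: "\<not> \<bar>X w - x\<bar> < k * \<eta>"
        define m where "m = nat \<lceil>k * \<eta> / u\<rceil>"
        have "k * \<eta> / u \<ge> 0" using k \<eta> u by simp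
        then have m: "k * \<eta> / u \<le> real m" "real m < k * \<eta> / u + 1" unfolding m_def by linarith+
        have "X w - x = u * (real (fst w) - real (fst v0))" by (simp add: X_def x_def algebra_simps)
        then have "k * \<eta> \<le> u * \<bar>real (fst w) - real (fst v0)\<bar>" using far u(1) by (simp add: abs_mult)
        then have "k * \<eta> / u \<le> \<bar>real (fst w) - real (fst v0)\<bar>" using u(1) by (simp add: field_simps)
        then have mle: "m \<le> fst w - fst v0 \<or> m \<le> fst v0 - fst w" unfolding m_def by linarith
        \<comment> \<open>Left end of a run of \<open>Suc m\<close> columns that starts or ends at
          \<open>v0\<close> and lies within those visited on the way to \<open>w\<close>;
          \<open>m\<close> is the least number of column steps that cover
          \<open>k * \<eta>\<close>.\<close>
        define b where "b = (if fst v0 \<le> fst w then fst v0 else fst v0 - m)"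
        show False
        proof (rule no_cross[OF \<eta> u(1), of "R - j" m t "a + u * (real b - 1)"])
          show "u \<le> \<eta> / 2 ^ (R - j)" using u(2) \<eta>R(1) by simp
          show "k * \<eta> \<le> u * real m" using m(1) u(1) by (simp add: field_simps)
          have "u * real m \<le> k * \<eta> + u" using m(2) u(1) by (simp add: field_simps)
          also have "\<dots> \<le> 2 * k * \<eta>" using u(2) \<eta>R(2) k \<eta> mult_right_mono[of 1 k \<eta>] by linarith
          finally show "u * real m \<le> 2 * k * \<eta>" .
        next
          fix i assume "i \<le> m"
          then have "fst v0 \<le> b + i \<and> b + i \<le> fst w \<or> fst w \<le> b + i \<and> b + i \<le> fst v0"
            using mle by (auto simp: b_def)
          then obtain w' where w': "reach S v0 w'" "fst w' = b + i"
            using reach_fst_between[OF w(1)] by blast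
          then have "w' \<in> B" "d t (F w') \<le> 2 * D0" "Y w' \<le> \<eta>" 
            using reach_in[OF w'(1)] by (auto simp: A_def S_def)
          then show "\<exists>z. Re z = a + u * (real b - 1) + u * real i \<and> \<eta> / 2 ^ (R - j) \<le> Im z \<and>
              Im z \<le> \<eta> \<and> d t (g z) \<le> 2 * D0"
            using Y_range[of w'] w'(2) \<eta>R(1)
            by (intro exI[of _ "Complex (X w') (Y w')"]) (auto simp: F_def X_def algebra_simps)
        qed (rule t)
      qed
      then have "(X w - x)\<^sup>2 \<le> (k * \<eta>)\<^sup>2" using k \<eta>
        by (metis abs_ge_zero less_imp_le power2_abs power_mono)
      moreover have "(Y w - \<eta>)\<^sup>2 \<le> (\<eta> / 2)\<^sup>2"
      proof -
        have "\<bar>Y w - \<eta>\<bar> \<le> \<bar>\<eta> / 2\<bar>" using w(2) wA(2) by linarith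
        then show ?thesis by (simp only: abs_le_square_iff)
      qed
      moreover have "(k * \<eta>)\<^sup>2 + (\<eta> / 2)\<^sup>2 \<le> (2 * k\<^sup>2 + 1) * (\<eta> / 2 * \<eta>)"
        by (simp add: power2_eq_square algebra_simps)
      ultimately have "(X w - x)\<^sup>2 + (Y w - \<eta>)\<^sup>2 \<le> (2 * k\<^sup>2 + 1) * (\<eta> / 2 * \<eta>)"
        by linarith
      also have "\<dots> \<le> (2 * k\<^sup>2 + 1) * (Y w * \<eta>)"
        using w(2) \<eta> by (intro mult_left_mono mult_right_mono) auto
      finally have "d (F w) (g (Complex x \<eta>)) \<le> c1"
        unfolding F_def c1_def using Y_pos \<eta> by (intro dT_le_nat) auto
      moreover have "d t (g (Complex x \<eta>)) \<le> d t (F w) + d (F w) (g (Complex x \<eta>))"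
        using t f_in Y_pos \<eta> unfolding F_def by (intro d_triangle) auto
      ultimately show ?thesis using wA(1) by (simp add: A_def \<eta>_def)
    qed
    have top: "d (g (Complex a h)) (g (Complex x h)) \<le> c1"
      unfolding c1_def
    proof (rule dT_le_nat)
      have "(a - x)\<^sup>2 \<le> (k * h)\<^sup>2" using x by (intro abs_le_square_iff[THEN iffD1]) auto
      also have "\<dots> = k\<^sup>2 * (h * h)" by (simp add: power2_eq_square)
      also have "\<dots> \<le> (2 * k\<^sup>2 + 1) * (h * h)" by (intro mult_right_mono) auto
      finally show "(Re (Complex a h) - Re (Complex x h))\<^sup>2 + (Im (Complex a h) - Im (Complex x h))\<^sup>2
          \<le> (2 * k\<^sup>2 + 1) * (Im (Complex a h) * Im (Complex x h))" by simp
    qed (use h in auto)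
    show "\<exists>x. a \<le> x \<and> x \<le> a + k * h \<and>
      (\<forall>j\<le>R. d (g (Complex a h)) (g (Complex x (h / 2 ^ j))) \<le> 4 * D0 + 3 * c1)"
    proof (intro exI[of _ x] conjI x allI impI)
      fix j assume j: "j \<le> R"
      let ?a = "g (Complex a h)" and ?b = "g (Complex x h)" and ?c = "g (Complex x (h / 2 ^ j))"
      have V: "?a \<in> VT" "?b \<in> VT" "?c \<in> VT" using f_in h by auto
      have "d ?a ?c \<le> d ?a ?b + d ?b ?c" "d ?b ?c \<le> d ?b t + d t ?c" "d ?b t = d t ?b"
        using V t by (auto intro: d_triangle d_sym)
      then show "d ?a ?c \<le> 4 * D0 + 3 * c1" using top near_t[OF j] near_t[of 0] by simp
    qed
  qed
qed

text \<open>Along the vertical geodesic below \<open>Complex a h\<close> given by \<open>vertical_geodesic\<close>, apply the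
  induction hypothesis at points \<open>2 h / 2 ^ l\<close> to its right, for \<open>l\<close> in a sufficiently sparse
  arithmetic progression. The sets of end points obtained in this way are pairwise separated.\<close>
lemma many_branches:
  "\<exists>W c s. W \<ge> 0 \<and> c > 0 \<and> (\<forall>a h R. h > 0 \<longrightarrow> (\<exists>X. finite X \<and> X \<subseteq> {a..a + W * h} \<and>
    (\<forall>x\<in>X. \<forall>y\<in>X. x \<noteq> y \<longrightarrow> h / 2 ^ R \<le> \<bar>x - y\<bar>) \<and> c * real R ^ m \<le> real (card X) \<and>
    (\<forall>x\<in>X. d (g (Complex a h)) (g (Complex x (h / 2 ^ R))) \<le> s)))"
proof (induction m)
  case 0
  obtain k c where k: "k \<ge> 1" and *: "\<And>a h R. h > 0 \<Longrightarrow> \<exists>x. a \<le> x \<and> x \<le> a + k * h \<and>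
      (\<forall>j\<le>R. d (g (Complex a h)) (g (Complex x (h / 2 ^ j))) \<le> c)"
    using vertical_geodesic by blast
  show ?case
  proof (rule exI[of _ k], rule exI[of _ 1], rule exI[of _ c], intro conjI allI impI)
    fix a h :: real and R :: nat assume "h > 0"
    from *[OF this, of a R] obtain x where "a \<le> x" "x \<le> a + k * h"
      "d (g (Complex a h)) (g (Complex x (h / 2 ^ R))) \<le> c" by blast
    then show "\<exists>X. finite X \<and> X \<subseteq> {a..a + k * h} \<and>
      (\<forall>x\<in>X. \<forall>y\<in>X. x \<noteq> y \<longrightarrow> h / 2 ^ R \<le> \<bar>x - y\<bar>) \<and> 1 * real R ^ 0 \<le> real (card X) \<and>
      (\<forall>x\<in>X. d (g (Complex a h)) (g (Complex x (h / 2 ^ R))) \<le> c)"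
      by (intro exI[of _ "{x}"]) auto
  qed (use k in auto)
next
  case (Suc m)
  obtain k c0 where k: "k \<ge> 1" and vert: "\<And>a h R. h > 0 \<Longrightarrow> \<exists>x. a \<le> x \<and> x \<le> a + k * h \<and>
      (\<forall>j\<le>R. d (g (Complex a h)) (g (Complex x (h / 2 ^ j))) \<le> c0)"
    using vertical_geodesic by blast
  obtain W c s where W: "W \<ge> 0" and c: "c > 0" and IH:
    "\<And>a h R. h > 0 \<Longrightarrow> \<exists>X. finite X \<and> X \<subseteq> {a..a + W * h} \<and>
    (\<forall>x\<in>X. \<forall>y\<in>X. x \<noteq> y \<longrightarrow> h / 2 ^ R \<le> \<bar>x - y\<bar>) \<and> c * real R ^ m \<le> real (card X) \<and>
    (\<forall>x\<in>X. d (g (Complex a h)) (g (Complex x (h / 2 ^ R))) \<le> s)"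
    using Suc.IH by blast
  \<comment> \<open>Cost of moving right by twice the height: \<open>(2 * \<eta>)\<close> squared is
    \<open>4 * (\<eta> * \<eta>)\<close>, hence \<open>q = 4\<close>.\<close>
  define c1 where "c1 = nat \<lceil>\<kappa> * (1 + ln (2 + 4))\<rceil>"
  \<comment> \<open>The end points of branch \<open>i\<close> lie between
    \<open>2 * \<eta> i\<close> and \<open>(2 + W) * \<eta> i\<close> to the right of
    \<open>x\<close>. With \<open>2 + W \<le> 2 ^ J\<close> those of all later branches lie within
    \<open>\<eta> i\<close> of \<open>x\<close>, which leaves a gap of at least
    \<open>\<eta> i\<close>.\<close>
  obtain J0 :: nat where J0: "2 + W < 2 ^ J0" using real_arch_pow[of 2 "2 + W"] by auto
  define J where "J = Suc J0"
  have "(2::real) ^ J0 \<le> 2 ^ J" by (simp add: J_def)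
  then have J: "J \<ge> 1" "2 + W \<le> 2 ^ J" using J0 by (simp add: J_def, linarith)
  show ?case
  proof (rule exI[of _ "k + 2 + W"], rule exI[of _ "c / (2 * J * 2 ^ m)"],
      rule exI[of _ "c0 + c1 + s"], intro conjI allI impI)
    fix a h :: real and R :: nat assume h: "h > 0"
    obtain x where x: "a \<le> x" "x \<le> a + k * h"
      and gx: "\<And>j. j \<le> R \<Longrightarrow> d (g (Complex a h)) (g (Complex x (h / 2 ^ j))) \<le> c0"
      using vert[OF h, of a R] by blast
    define \<eta> where "\<eta> i = h / 2 ^ (J * i)" for i
    have \<eta>: "\<eta> i > 0" "\<eta> i \<le> h" for i using h by (auto simp: \<eta>_def field_simps)
    \<comment> \<open>Branching only in the upper half leaves depth at least \<open>R / 2\<close> to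
      each branch. The more than \<open>R / (2 * J)\<close> branches then give the factor
      \<open>c / (2 * J * 2 ^ m)\<close>.\<close>
    define N where "N = R div (2 * J)"
    have JN: "2 * (J * i) \<le> R" if "i \<le> N" for i
    proof -
      have "2 * (J * i) \<le> 2 * J * N" using that by simp
      also have "\<dots> \<le> R" by (simp add: N_def)
      finally show ?thesis .
    qed
    have \<eta>R: "\<eta> i / 2 ^ (R - J * i) = h / 2 ^ R" if "i \<le> N" for i
    proof -
      have "(2::real) ^ R = 2 ^ (J * i) * 2 ^ (R - J * i)" using JN[OF that] by (simp flip: power_add)
      then show ?thesis by (simp add: \<eta>_def)
    qed
    have \<eta>R': "h / 2 ^ R \<le> \<eta> i" if "i \<le> N" for i
      unfolding \<eta>R[OF that, symmetric] using \<eta>(1)[of i] by (simp add: field_simps)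
    have "\<forall>i. \<exists>X. finite X \<and> X \<subseteq> {x + 2 * \<eta> i..x + 2 * \<eta> i + W * \<eta> i} \<and>
        (\<forall>x\<in>X. \<forall>y\<in>X. x \<noteq> y \<longrightarrow> \<eta> i / 2 ^ (R - J * i) \<le> \<bar>x - y\<bar>) \<and>
        c * real (R - J * i) ^ m \<le> real (card X) \<and>
        (\<forall>y\<in>X. d (g (Complex (x + 2 * \<eta> i) (\<eta> i))) (g (Complex y (\<eta> i / 2 ^ (R - J * i)))) \<le> s)"
      using IH[OF \<eta>(1)] by blast
    then obtain X where X: "\<And>i. finite (X i)" "\<And>i. X i \<subseteq> {x + 2 * \<eta> i..x + 2 * \<eta> i + W * \<eta> i}"
      "\<And>i y y'. y \<in> X i \<Longrightarrow> y' \<in> X i \<Longrightarrow> y \<noteq> y' \<Longrightarrow> \<eta> i / 2 ^ (R - J * i) \<le> \<bar>y - y'\<bar>"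
      "\<And>i. c * real (R - J * i) ^ m \<le> real (card (X i))"
      "\<And>i y. y \<in> X i \<Longrightarrow>
        d (g (Complex (x + 2 * \<eta> i) (\<eta> i))) (g (Complex y (\<eta> i / 2 ^ (R - J * i)))) \<le> s"
      by metis
    have sep: "\<eta> i \<le> y - y'" if "i < i'" "y \<in> X i" "y' \<in> X i'" for i i' y y'
    proof -
      have "J + J * i \<le> J * i'" using that(1) by (metis Suc_leI mult_Suc_right mult_le_mono2)
      then have "(2::real) ^ (J + J * i) \<le> 2 ^ (J * i')" by (intro power_increasing) auto
      moreover have "(2 + W) * 2 ^ (J * i) \<le> 2 ^ J * 2 ^ (J * i)" using J(2) by (intro mult_right_mono) auto
      ultimately have "(2 + W) * 2 ^ (J * i) \<le> 2 ^ (J * i')" unfolding power_add by linarith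
      then have "h * ((2 + W) * 2 ^ (J * i)) \<le> h * 2 ^ (J * i')" using h by (intro mult_left_mono) auto
      then have "(2 + W) * \<eta> i' \<le> \<eta> i" by (simp add: \<eta>_def field_simps)
      moreover have "x + 2 * \<eta> i \<le> y" "y' \<le> x + (2 + W) * \<eta> i'" using that X(2) by (force simp: algebra_simps)+
      ultimately show ?thesis by linarith
    qed
    have disj: "X i \<inter> X i' = {}" if "i \<noteq> i'" for i i'
    proof -
      have "X i \<inter> X i' = {}" if "i < i'" for i i' using sep[OF that] \<eta>(1)[of i] by force
      from this[of i i'] this[of i' i] \<open>i \<noteq> i'\<close> show ?thesis by (metis inf_commute nat_neq_iff)
    qed
    define U where "U = (\<Union>i\<le>N. X i)"
    show "\<exists>X. finite X \<and> X \<subseteq> {a..a + (k + 2 + W) * h} \<and>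
      (\<forall>x\<in>X. \<forall>y\<in>X. x \<noteq> y \<longrightarrow> h / 2 ^ R \<le> \<bar>x - y\<bar>) \<and>
      c / (2 * J * 2 ^ m) * real R ^ Suc m \<le> real (card X) \<and>
      (\<forall>x\<in>X. d (g (Complex a h)) (g (Complex x (h / 2 ^ R))) \<le> c0 + c1 + s)"
    proof (intro exI[of _ U] conjI ballI impI)
      show "finite U" using X(1) by (simp add: U_def)
      show "U \<subseteq> {a..a + (k + 2 + W) * h}"
      proof
        fix y assume "y \<in> U"
        then obtain i where i: "y \<in> X i" by (auto simp: U_def)
        then have "x + 2 * \<eta> i \<le> y" "y \<le> x + 2 * \<eta> i + W * \<eta> i" using X(2) by force+
        moreover have "W * \<eta> i \<le> W * h" using \<eta>[of i] W by (intro mult_left_mono) auto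
        ultimately show "y \<in> {a..a + (k + 2 + W) * h}" using x \<eta>[of i] by (auto simp: algebra_simps)
      qed
      show "h / 2 ^ R \<le> \<bar>y - y'\<bar>" if "y \<in> U" "y' \<in> U" "y \<noteq> y'" for y y'
      proof -
        obtain i i' where i: "i \<le> N" "i' \<le> N" "y \<in> X i" "y' \<in> X i'" 
          using \<open>y \<in> U\<close> \<open>y' \<in> U\<close> by (auto simp: U_def)
        show ?thesis
        proof (cases i i' rule: linorder_cases)
          case less
          then show ?thesis using sep[OF less i(3,4)] \<eta>R'[OF i(1)] by linarith
        next
          case equal
          then show ?thesis using X(3)[of y i y'] i \<open>y \<noteq> y'\<close> \<eta>R[OF i(1)] by simp
        next
          case greater
          then show ?thesis using sep[OF greater i(4,3)] \<eta>R'[OF i(2)] by linarith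
        qed
      qed
      show "d (g (Complex a h)) (g (Complex y (h / 2 ^ R))) \<le> c0 + c1 + s" if "y \<in> U" for y
      proof -
        obtain i where i: "i \<le> N" "y \<in> X i" using \<open>y \<in> U\<close> by (auto simp: U_def)
        let ?p = "g (Complex a h)" and ?q = "g (Complex x (\<eta> i))"
          and ?r = "g (Complex (x + 2 * \<eta> i) (\<eta> i))" and ?s = "g (Complex y (h / 2 ^ R))"
        have V: "?p \<in> VT" "?q \<in> VT" "?r \<in> VT" "?s \<in> VT" using f_in h \<eta>(1) by auto
        have "d ?p ?q \<le> c0" using gx[of "J * i"] JN[OF i(1)] by (simp add: \<eta>_def)
        moreover have "d ?q ?r \<le> c1" unfolding c1_def
          by (rule dT_le_nat) (use \<eta>(1)[of i] in \<open>auto simp: power2_eq_square\<close>)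
        moreover have "d ?r ?s \<le> s" using X(5)[OF i(2)] \<eta>R[OF i(1)] by simp
        moreover have "d ?p ?s \<le> d ?p ?q + d ?q ?s" "d ?q ?s \<le> d ?q ?r + d ?r ?s"
          using V by (auto intro: d_triangle)
        ultimately show ?thesis by linarith
      qed
      have "real R / (2 * J) \<le> real N + 1"
      proof -
        have "R < 2 * J * (N + 1)" using J(1) dividend_less_div_times[of "2 * J" R] by (simp add: N_def algebra_simps)
        then have "real R \<le> real (2 * J * (N + 1))" by (simp only: of_nat_le_iff less_imp_le)
        then show ?thesis using J(1) by (simp add: field_simps)
      qed
      then have "real R / (2 * J) * (c * (real R / 2) ^ m) \<le> (real N + 1) * (c * (real R / 2) ^ m)"
        using c by (intro mult_right_mono) auto
      also have "\<dots> = (\<Sum>i\<le>N. c * (real R / 2) ^ m)" by simp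
      also have "\<dots> \<le> (\<Sum>i\<le>N. real (card (X i)))"
      proof (rule sum_mono)
        fix i assume "i \<in> {..N}"
        then have "2 * (J * i) \<le> R" using JN by simp
        then have "real R / 2 \<le> real (R - J * i)" by linarith
        then have "c * (real R / 2) ^ m \<le> c * real (R - J * i) ^ m"
          using c by (intro mult_left_mono power_mono) auto
        then show "c * (real R / 2) ^ m \<le> real (card (X i))" using X(4)[of i] by linarith
      qed
      also have "\<dots> = real (card U)"
        unfolding U_def using X(1) disj by (subst card_UN_disjoint) auto
      finally show "c / (2 * J * 2 ^ m) * real R ^ Suc m \<le> real (card U)"
        by (simp add: power_divide mult.commute mult.left_commute)
    qed
  qed (use k W c J in auto)
qed

text \<open>At height \<open>1 / 2 ^ R\<close> the end points spread over \<open>W * 2 ^ R\<close>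
  times their height, so the logarithm in \<open>level_card\<close> is linear in \<open>R\<close>.
  As \<open>W\<close>, \<open>c\<close> and \<open>s\<close> do not depend on \<open>R\<close>, a
  lower bound of degree \<open>D + 1\<close> meets an upper bound of degree
  \<open>D\<close>.\<close>

lemma no_H2_map: False
proof -
  obtain W c s where W: "W \<ge> 0" and c: "c > 0" and branches:
    "\<And>a h R. h > 0 \<Longrightarrow> \<exists>X. finite X \<and> X \<subseteq> {a..a + W * h} \<and>
    (\<forall>x\<in>X. \<forall>y\<in>X. x \<noteq> y \<longrightarrow> h / 2 ^ R \<le> \<bar>x - y\<bar>) \<and> c * real R ^ Suc D \<le> real (card X) \<and>
    (\<forall>x\<in>X. d (g (Complex a h)) (g (Complex x (h / 2 ^ R))) \<le> s)"
    using many_branches[of "Suc D"] by blast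
  define K where "K = 13 * \<kappa> * 4 ^ s * C"
  define b where "b = 1 + \<kappa> * (1 + ln (3 + 4 * W\<^sup>2)) + 3 * \<kappa>"
  have lnW: "ln (3 + 4 * W\<^sup>2) \<ge> 0" by (intro ln_ge_zero) (simp add: add_increasing2)
  have K: "K \<ge> 0" using \<kappa>_pos C_pos by (simp add: K_def)
  have main: "c * real R \<le> K * b ^ D" if R: "R \<ge> 1" for R
  proof -
    define \<eta> where "\<eta> = (1::real) / 2 ^ R"
    have \<eta>: "\<eta> > 0" by (simp add: \<eta>_def)
    obtain X where "finite X \<and> X \<subseteq> {0..0 + W * 1} \<and>
      (\<forall>x\<in>X. \<forall>y\<in>X. x \<noteq> y \<longrightarrow> 1 / 2 ^ R \<le> \<bar>x - y\<bar>) \<and> c * real R ^ Suc D \<le> real (card X) \<and>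
      (\<forall>x\<in>X. d (g (Complex 0 1)) (g (Complex x (1 / 2 ^ R))) \<le> s)"
      using branches[OF zero_less_one, of 0 R] by blast
    then have X: "finite X" "X \<subseteq> {0..W}" "\<And>x y. x \<in> X \<Longrightarrow> y \<in> X \<Longrightarrow> x \<noteq> y \<Longrightarrow> \<eta> \<le> \<bar>x - y\<bar>"
      "c * real R ^ Suc D \<le> real (card X)" "\<And>x. x \<in> X \<Longrightarrow> d (g (Complex 0 1)) (g (Complex x \<eta>)) \<le> s"
      unfolding \<eta>_def by simp_all
    let ?S = "(\<lambda>x. Complex x \<eta>) ` X"
    have "real (card ?S) \<le> 13 * \<kappa> * 4 ^ s * C * (1 + \<kappa> * (1 + ln (3 + 4 * (W * 2 ^ R)\<^sup>2))) ^ D"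
    proof (rule level_card[OF _ \<eta>, where t = "g (Complex 0 1)"])
      show "inj_on (\<lambda>z. \<lfloor>Re z / \<eta>\<rfloor>) ?S"
      proof (rule inj_onI, clarsimp)
        fix x y assume xy: "x \<in> X" "y \<in> X" "\<lfloor>x / \<eta>\<rfloor> = \<lfloor>y / \<eta>\<rfloor>"
        then have "\<bar>x / \<eta> - y / \<eta>\<bar> < 1" by linarith
        then have "\<bar>x - y\<bar> < \<eta>" using \<eta> by (simp add: field_simps flip: diff_divide_distrib)
        then show "x = y" using X(3)[OF xy(1,2)] by linarith
      qed
      show "\<bar>Re z - Re w\<bar> \<le> W * 2 ^ R * \<eta>" if "z \<in> ?S" "w \<in> ?S" for z w
      proof -
        from that X(2) have "Re z \<in> {0..W}" "Re w \<in> {0..W}" by auto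
        then have "\<bar>Re z - Re w\<bar> \<le> W" by auto
        then show ?thesis by (simp add: \<eta>_def)
      qed
    qed (use X \<eta> f_in in auto)
    moreover have "card ?S = card X" by (rule card_image) (auto simp: inj_on_def)
    moreover have "1 + \<kappa> * (1 + ln (3 + 4 * (W * 2 ^ R)\<^sup>2)) \<le> b * R"
    proof -
      have "(2 ^ R)\<^sup>2 = (4 :: real) ^ R" by (simp add: power2_eq_square flip: power_mult_distrib)
      then have "3 + 4 * (W * 2 ^ R)\<^sup>2 \<le> (3 + 4 * W\<^sup>2) * 4 ^ R"
        by (simp add: power_mult_distrib algebra_simps)
      then have "ln (3 + 4 * (W * 2 ^ R)\<^sup>2) \<le> ln ((3 + 4 * W\<^sup>2) * 4 ^ R)"
        by (subst ln_le_cancel_iff) (auto simp: add_pos_nonneg)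
      also have "\<dots> = ln (3 + 4 * W\<^sup>2) + R * ln 4"
      proof -
        have "3 + 4 * W\<^sup>2 > 0" by (simp add: add_pos_nonneg)
        then show ?thesis by (simp add: ln_mult ln_realpow)
      qed
      also have "\<dots> \<le> ln (3 + 4 * W\<^sup>2) + R * 3"
        using ln_le_minus_one[of 4] mult_left_mono[of "ln 4" 3 "real R"] by linarith
      finally have "\<kappa> * (1 + ln (3 + 4 * (W * 2 ^ R)\<^sup>2)) \<le> \<kappa> * (1 + ln (3 + 4 * W\<^sup>2) + R * 3)"
        using \<kappa>_pos by (intro mult_left_mono) auto
      moreover have "1 + \<kappa> * (1 + ln (3 + 4 * W\<^sup>2)) \<le> (1 + \<kappa> * (1 + ln (3 + 4 * W\<^sup>2))) * R"
        using R \<kappa>_pos lnW mult_left_mono[of 1 "real R" "1 + \<kappa> * (1 + ln (3 + 4 * W\<^sup>2))"] by simp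
      ultimately show ?thesis by (simp add: b_def algebra_simps)
    qed
    moreover have "ln (3 + 4 * (W * 2 ^ R)\<^sup>2) \<ge> 0" by (intro ln_ge_zero) (simp add: add_increasing2)
    ultimately have "c * real R ^ Suc D \<le> K * (b * R) ^ D"
    proof -
      assume "ln (3 + 4 * (W * 2 ^ R)\<^sup>2) \<ge> 0" 
        and le: "1 + \<kappa> * (1 + ln (3 + 4 * (W * 2 ^ R)\<^sup>2)) \<le> b * R"
        and "real (card ?S) \<le> 13 * \<kappa> * 4 ^ s * C * (1 + \<kappa> * (1 + ln (3 + 4 * (W * 2 ^ R)\<^sup>2))) ^ D"
        and "card ?S = card X"
      moreover have "K * (1 + \<kappa> * (1 + ln (3 + 4 * (W * 2 ^ R)\<^sup>2))) ^ D \<le> K * (b * R) ^ D"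
        using K le \<kappa>_pos \<open>ln (3 + 4 * (W * 2 ^ R)\<^sup>2) \<ge> 0\<close> by (intro mult_left_mono power_mono) auto
      ultimately show ?thesis using X(4) by (simp add: K_def)
    qed
    then have "(c * real R) * real R ^ D \<le> (K * b ^ D) * real R ^ D"
      by (simp add: power_mult_distrib algebra_simps)
    then show ?thesis using R by (simp add: mult_le_cancel_right)
  qed
  obtain R :: nat where "K * b ^ D / c < R" using reals_Archimedean2 by blast
  then have "K * b ^ D < c * real (Suc R)" using c by (simp add: field_simps)
  then show False using main[of "Suc R"] by simp
qed

end

theorem theoremA:
  fixes VT :: "'a set" and ET :: "'a \<Rightarrow> 'a \<Rightarrow> bool"
    and VZ :: "'b set" and EZ :: "'b \<Rightarrow> 'b \<Rightarrow> bool"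
  assumes "is_T3 VT ET"
    and "simple_graph VZ EZ" and "graph_connected VZ EZ" and "VZ \<noteq> {}"
    and "bounded_degree VZ EZ" and "polynomial_growth VZ EZ"
  shows "\<not> (\<exists>f :: complex \<Rightarrow> 'a \<times> 'b.
            regular_map H2 hdist (VT \<times> VZ) (l1_prod_dist (gdist VT ET) (gdist VZ EZ)) f)"
proof
  assume "\<exists>f :: complex \<Rightarrow> 'a \<times> 'b.
    regular_map H2 hdist (VT \<times> VZ) (l1_prod_dist (gdist VT ET) (gdist VZ EZ)) f"
  then obtain f :: "complex \<Rightarrow> 'a \<times> 'b"
    where reg: "regular_map H2 hdist (VT \<times> VZ) (l1_prod_dist (gdist VT ET) (gdist VZ EZ)) f" ..
  then have f: "f ` H2 \<subseteq> VT \<times> VZ" unfolding regular_map_def by (rule conjunct1)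
  from reg[unfolded regular_map_def, THEN conjunct2] obtain \<kappa> where \<kappa>:
    "(\<forall>x\<in>H2. \<forall>x'\<in>H2. l1_prod_dist (gdist VT ET) (gdist VZ EZ) (f x) (f x') \<le> \<kappa> * (1 + hdist x x')) \<and>
     (\<forall>y\<in>VT \<times> VZ. \<exists>Cs. finite Cs \<and> Cs \<subseteq> H2 \<and> real (card Cs) \<le> \<kappa> \<and>
        {x \<in> H2. l1_prod_dist (gdist VT ET) (gdist VZ EZ) y (f x) < 1} \<subseteq> (\<Union>c\<in>Cs. {x \<in> H2. hdist c x < 1}))"
    by (rule exE)
  note lip = \<kappa>[THEN conjunct1, rule_format] and fibre = \<kappa>[THEN conjunct2, rule_format]
  obtain C e :: real where C: "C > 0" "e > 0" and growth: "\<And>z r. z \<in> VZ \<Longrightarrow> r \<ge> 0 \<Longrightarrow>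
      finite {v \<in> VZ. gdist VZ EZ z v \<le> r} \<and> real (card {v \<in> VZ. gdist VZ EZ z v \<le> r}) \<le> C * r powr e + C"
    using assms(6) unfolding polynomial_growth_def by blast
  define D where "D = nat \<lceil>e\<rceil>"
  have poly: "C * r powr e + C \<le> 2 * C * (1 + r) ^ D" if "r \<ge> 0" for r
  proof -
    have "r powr e \<le> (1 + r) powr e" using that C(2) by (intro powr_mono2) auto
    also have "\<dots> \<le> (1 + r) powr D" using that unfolding D_def by (intro powr_mono real_nat_ceiling_ge) auto
    also have "\<dots> = (1 + r) ^ D" using that by (intro powr_realpow) auto
    finally have "C * r powr e \<le> C * (1 + r) ^ D" using C by simp
    moreover have "C * 1 \<le> C * (1 + r) ^ D" using that C by (intro mult_left_mono one_le_power) auto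
    ultimately show ?thesis by simp
  qed
  have tree: "is_tree VT ET" and deg: "\<And>v. v \<in> VT \<Longrightarrow> finite {w \<in> VT. ET v w} \<and> degree VT ET v = 3"
    using assms(1) unfolding is_T3_def by auto
  interpret tree VT ET
    using tree unfolding is_tree_def by unfold_locales auto
  have fV: "fst (f z) \<in> VT" "snd (f z) \<in> VZ" if "Im z > 0" for z
    using f that by (force simp: H2_def)+
  have fibre': "\<exists>Cs. finite Cs \<and> Cs \<subseteq> H2 \<and> real (card Cs) \<le> \<kappa> \<and>
      {x \<in> H2. f x = f z} \<subseteq> (\<Union>c\<in>Cs. {x \<in> H2. hdist c x < 1})" if z: "Im z > 0" for z
  proof -
    have "f z \<in> VT \<times> VZ" using fV[OF z] by (simp add: mem_Times_iff)
    moreover have "l1_prod_dist (gdist VT ET) (gdist VZ EZ) (f z) (f z) = 0"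
      using fV[OF z] by (simp add: l1_prod_dist_def gdist_wdist wdist_refl)
    ultimately show ?thesis using fibre[of "f z"] by fastforce
  qed
  \<comment> \<open>Passing from \<open>\<kappa>\<close> to \<open>max 1 \<kappa>\<close> weakens
    both conditions and makes the constant positive; \<open>2 * C\<close> comes from absorbing the
    additive \<open>C\<close> of the growth bound.\<close>
  have "H2_map VT ET (gdist VZ EZ) VZ f \<bar>max 1 \<kappa>\<bar> (2 * C) D"
  proof unfold_locales
    show "finite {w \<in> VT. ET v w} \<and> card {w \<in> VT. ET v w} \<le> 3" if "v \<in> VT" for v
      using deg[OF that] by (simp add: degree_def)
    show "finite {v \<in> VZ. gdist VZ EZ z v \<le> r} \<and>
        real (card {v \<in> VZ. gdist VZ EZ z v \<le> r}) \<le> 2 * C * (1 + r) ^ D"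
      if "z \<in> VZ" "r \<ge> 0" for z r
      using growth[OF that] poly[OF that(2)] by linarith
    show "real (d (fst (f z)) (fst (f w))) + gdist VZ EZ (snd (f z)) (snd (f w))
        \<le> \<bar>max 1 \<kappa>\<bar> * (1 + hdist z w)" if "Im z > 0" "Im w > 0" for z w
    proof -
      have "hdist z w \<ge> 0" using that unfolding hdist_def by (intro arcosh_nonneg_real) simp
      then have "\<kappa> * (1 + hdist z w) \<le> \<bar>max 1 \<kappa>\<bar> * (1 + hdist z w)"
        by (intro mult_right_mono) auto
      then show ?thesis using lip[of z w] that by (simp add: H2_def l1_prod_dist_def gdist_wdist)
    qed
    show "\<exists>Cs. finite Cs \<and> Cs \<subseteq> H2 \<and> real (card Cs) \<le> \<bar>max 1 \<kappa>\<bar> \<and>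
      {x \<in> H2. f x = f z} \<subseteq> (\<Union>c\<in>Cs. {x \<in> H2. hdist c x < 1})" if z: "Im z > 0" for z
      using fibre'[OF z] by fastforce
  qed (use C fV in \<open>auto simp: gdist_nonneg\<close>)
  then show False by (rule H2_map.no_H2_map)
qed

end
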